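(* Consider the hexagonal network under Model 1 with only Rx-cooperation and an unlimited number of cooperation rounds ($D=\infty$), as defined in the context. For $\rho\in(0,1)$ and $\rho_f\in(0,1]$, the fundamental MG region $\mathcal S_1^\star(D=\infty,\rho,\rho_f)$ includes all nonnegative pairs $(S^{(U)},S^{(e)})$ satisfying $$S^{(U)}\le\frac{\rho\rho_f}{3},\qquad S^{(e)}+L\cdot S^{(U)}\le\rho,\qquad\text{where } L=\frac{2+\rho_f-2(1-\rho\rho_f)^3}{\rho_f}.$$
   Context: Hexagonal network: for each $K$ there are $K$ hexagonal cells indexed by $\mathcal K=\{1,\dots,K\}$, each with one transmitter (Tx) and one receiver (Rx). Cell $k$ has position $o_k=a_k\mathbf e_x+b_k\mathbf e_y$ in the complex plane with distinct integer pairs $(a_k,b_k)$, where $\mathbf e_x=\frac{\sqrt3}{2}-\frac12 i$ and $\mathbf e_y=i$. The neighbour set and interference set of $k$ coincide: $\mathcal N_k=\mathcal I_k$ is the set of the (at most six) adjacent cells $k'\in\mathcal K$, i.e. those with $(a_k-a_{k'},b_k-b_{k'})\in\{\pm(1,0),\pm(0,1),\pm(1,1)\}$ (equivalently $|o_k-o_{k'}|=1$). Activity. Each Tx $k$ is active ($A_k=1$) with probability $\rho$, independently over $k$, and $A_k=0$ otherwise. Given that Tx $k$ is active, $B_k=1$ with probability $\rho_f$, independently of everything else, and $B_k=0$ otherwise. Let $\mathcal K_{active}=\{k:A_k=1\}$, $\mathcal K_{URLLC}=\{k:A_k=1,B_k=1\}$. Model 1: every active Tx has an eMBB message, i.e.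 $\mathcal K_{eMBB}=\mathcal K_{active}$, and each Tx in $\mathcal K_{URLLC}$ additionally has a URLLC message. Write $\mathbf A,\mathbf B$ for the activity tuples; all terminals know $(\mathbf A,\mathbf B)$. Messages. For blocklength $n$, the eMBB message $M_k^{(e)}$ ($k\in\mathcal K_{eMBB}$) is uniform on $\{1,\dots,\lfloor 2^{nR_k^{(e)}}\rfloor\}$, where $R_k^{(e)}$ may depend on $k$ and on $(\mathbf A,\mathbf B)$. The URLLC message $M_k^{(U)}$ ($k\in\mathcal K_{URLLC}$) is uniform on $\{1,\dots,\lfloor 2^{nR^{(U)}}\rfloor\}$, with the same rate $R^{(U)}$ for all $k$, not depending on $(\mathbf A,\mathbf B)$. Messages are independent. Channel. For $t=1,\dots,n$, $Y_{k,t}=h_{k,k}X_{k,t}+\sum_{\tilde k\in\mathcal I_k}h_{\tilde k,k}X_{\tilde k,t}+Z_{k,t}$, where inactive Txs send zero, the $h_{\tilde k,k}\ge 0$ are fixed real numbers, and the $Z_{k,t}$ are i.i.d. standard Gaussian, independent of all messages. Communication with only Rx-cooperation. (i) Each active Tx $k$ computes $X_k^n$ as a function of its own URLLC and eMBB messages (those that exist) and $(\mathbf A,\mathbf B)$, subject to $\frac1n\sum_{t=1}^n X_{k,t}^2\le P$ almost surely. (ii) Each Rx $k\in\mathcal K_{URLLC}$ decodes $M_k^{(U)}$ from $Y_k^n$ and $(\mathbf A,\mathbf B)$ only. (iii) Rx-cooperation rounds, whose number may be any finite number ($D=\infty$: no constraint on the number of rounds): in each round every active Rx $k$ sends to each active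 neighbour in $\mathcal N_k$ over a noise-free link of unlimited capacity an arbitrary function of $Y_k^n$, the cooperation messages it received in previous rounds, and $(\mathbf A,\mathbf B)$. (iv) Each Rx $k\in\mathcal K_{eMBB}$ decodes $M_k^{(e)}$ from $Y_k^n$, all cooperation messages it received, and $(\mathbf A,\mathbf B)$. Achievability. For given $P,K$, a pair $(R^{(U)}(P),\bar R_K^{(e)}(P))$ is achievable if there exist rates $R_k^{(e)}$ with $\bar R_K^{(e)}\le \mathbb E_{\mathbf A,\mathbf B}\big[\frac1K\sum_{k\in\mathcal K_{eMBB}}R_k^{(e)}\big]$ and encoding functions (of the own messages and $(\mathbf A,\mathbf B)$, obeying the power constraint $\frac1n\sum_{t=1}^n X_{k,t}^2\le P$ almost surely), URLLC decoding functions (of $Y_k^n$ and $(\mathbf A,\mathbf B)$), Rx-cooperation functions for some finite number of rounds (of $Y_k^n$, the previously received Rx-cooperation messages and $(\mathbf A,\mathbf B)$) and eMBB decoding functions (of $Y_k^n$, all received Rx-cooperation messages and $(\mathbf A,\mathbf B)$) such that the probability that some URLLC message ($k\in\mathcal K_{URLLC}$) or some eMBB message ($k\in\mathcal K_{eMBB}$) is decoded incorrectly tends to $0$ as $n\to\infty$. A multiplexing gain (MG) pair $(S^{(U)},S^{(e)})$ is achievable if for all $P>0$ (and all $K$) there exist achievable rates with $S^{(U)}=\rho\rho_f\,\varlimsup_{K\to\infty}\varlimsup_{P\to\infty}\frac{R^{(U)}(P)}{\frac12\log P}$ and $S^{(e)}=\varlimsup_{K\to\infty}\varlimsup_{P\to\infty}\frac{\bar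 R_K^{(e)}(P)}{\frac12\log P}$. The fundamental MG region $\mathcal S_1^\star(D=\infty,\rho,\rho_f)$ is here the closure of the set of all achievable MG pairs under Model 1 with only Rx-cooperation.
   Formalization: The formal theorem additionally assumes that, for every set of cells, the channel matrix between its Txs and Rxs is nonsingular (in particular h_{k,k} ≠ 0); without this the claim fails, e.g. when all gains are zero. *)

theory Defs
  imports "HOL-Probability.Probability"
begin

section \<open>Hexagonal network\<close>

definition hex_position :: "int \<times> int \<Rightarrow> complex" where
  "hex_position p = of_int (fst p) * Complex (sqrt 3 / 2) (- 1 / 2) + of_int (snd p) * \<i>"

definition adjacent :: "int \<times> int \<Rightarrow> int \<times> int \<Rightarrow> bool" where
  "adjacent p q \<longleftrightarrow> (fst p - fst q, snd p - snd q)
     \<in> {(1, 0), (-1, 0), (0, 1), (0, -1), (1, 1), (-1, -1)}"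

lemma adjacent_iff_dist:
  "adjacent p q \<longleftrightarrow> dist (hex_position p) (hex_position q) = 1"
proof -
  define a b where "a = fst p - fst q" and "b = snd p - snd q"
  have "hex_position p - hex_position q
      = Complex (sqrt 3 / 2 * of_int a) (of_int b - of_int a / 2)"
    by (simp add: hex_position_def a_def b_def complex_eq_iff field_simps)
  then have "dist (hex_position p) (hex_position q)
      = sqrt ((sqrt 3 / 2 * of_int a)\<^sup>2 + (of_int b - of_int a / 2)\<^sup>2)"
    by (simp add: dist_norm cmod_def)
  also have "(sqrt 3 / 2 * of_int a)\<^sup>2 + (of_int b - of_int a / 2)\<^sup>2
      = real_of_int (a\<^sup>2 - a * b + b\<^sup>2)"
    by (simp add: power_mult_distrib power_divide) (simp add: power2_eq_square field_simps)
  finally have d: "dist (hex_position p) (hex_position q) = 1 \<longleftrightarrow> a\<^sup>2 - a * b + b\<^sup>2 = 1"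
    by (metis of_int_1 of_int_eq_iff real_sqrt_eq_1_iff)
  have "(a, b) \<in> {(1, 0), (-1, 0), (0, 1), (0, -1), (1, 1), (-1, -1)}"
    if eq: "a\<^sup>2 - a * b + b\<^sup>2 = 1"
  proof -
    have eqa: "(2 * b - a)\<^sup>2 + 3 * a\<^sup>2 = 4" and eqb: "(2 * a - b)\<^sup>2 + 3 * b\<^sup>2 = 4"
      using eq by (simp_all add: power2_eq_square algebra_simps)
    have bound: "\<bar>x\<bar> \<le> 1" if "y\<^sup>2 + 3 * x\<^sup>2 = 4" for x y :: int
    proof (rule ccontr)
      assume "\<not> \<bar>x\<bar> \<le> 1"
      then have "2\<^sup>2 \<le> \<bar>x\<bar>\<^sup>2" by (intro power_mono) auto
      then show False using that zero_le_power2[of y] by simp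
    qed
    have "a \<in> {-1, 0, 1}" "b \<in> {-1, 0, 1}"
      using bound[OF eqa] bound[OF eqb] by auto
    then show ?thesis using eq by auto
  qed
  moreover have "a\<^sup>2 - a * b + b\<^sup>2 = 1"
    if "(a, b) \<in> {(1, 0), (-1, 0), (0, 1), (0, -1), (1, 1), (-1, -1)}"
    using that by auto
  ultimately show ?thesis
    unfolding d adjacent_def a_def[symmetric] b_def[symmetric] by blast
qed

definition neighbours :: "nat \<Rightarrow> (nat \<Rightarrow> int \<times> int) \<Rightarrow> nat \<Rightarrow> nat set" where
  "neighbours K pos k = {j \<in> {1..K}. adjacent (pos j) (pos k)}"

text \<open>
  Below, \<open>h j k\<close> is the gain from transmitter \<open>j\<close> to receiver \<open>k\<close>; it is only used when
  \<open>j = k\<close> or \<open>j\<close> is a neighbour of \<open>k\<close>. The following condition says that for every set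
  \<open>A\<close> of cells the square channel matrix between the transmitters and the receivers
  of \<open>A\<close> is nonsingular (the case of singletons gives \<open>h k k \<noteq> 0\<close>). It only excludes the zero
  set of finitely many nonzero polynomials in the gains.
\<close>

definition nonsingular_channels ::
  "nat \<Rightarrow> (nat \<Rightarrow> int \<times> int) \<Rightarrow> (nat \<Rightarrow> nat \<Rightarrow> real) \<Rightarrow> bool" where
  "nonsingular_channels K pos h \<longleftrightarrow>
     (\<forall>A \<subseteq> {1..K}. \<forall>x :: nat \<Rightarrow> real.
        (\<forall>k\<in>A. h k k * x k + (\<Sum>j \<in> neighbours K pos k \<inter> A. h j k * x j) = 0)
        \<longrightarrow> (\<forall>k\<in>A. x k = 0))"


section \<open>Activity and messages\<close>

text \<open>An activity state maps cell \<open>k\<close> to the pair \<open>(A_k, B_k)\<close>.\<close>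

type_synonym state = "nat \<Rightarrow> bool \<times> bool"

definition cell_activity :: "real \<Rightarrow> real \<Rightarrow> (bool \<times> bool) pmf" where
  "cell_activity \<rho> \<rho>f = bind_pmf (bernoulli_pmf \<rho>)
     (\<lambda>a. if a then map_pmf (Pair True) (bernoulli_pmf \<rho>f) else return_pmf (False, False))"

definition activity :: "nat \<Rightarrow> real \<Rightarrow> real \<Rightarrow> state pmf" where
  "activity K \<rho> \<rho>f = Pi_pmf {1..K} (False, False) (\<lambda>_. cell_activity \<rho> \<rho>f)"

definition active :: "nat \<Rightarrow> state \<Rightarrow> nat set" where
  "active K s = {k \<in> {1..K}. fst (s k)}"

definition urllc :: "nat \<Rightarrow> state \<Rightarrow> nat set" where
  "urllc K s = {k \<in> {1..K}. fst (s k) \<and> snd (s k)}"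

text \<open>Model 1: every active transmitter has an eMBB message.\<close>

definition embb :: "nat \<Rightarrow> state \<Rightarrow> nat set" where
  "embb K s = active K s"

definition num_messages :: "nat \<Rightarrow> real \<Rightarrow> nat" where
  "num_messages n R = nat \<lfloor>2 powr (real n * R)\<rfloor>"

text \<open>
  Joint law of the activity state, the URLLC messages and the eMBB messages, for URLLC rate
  \<open>RU\<close> and eMBB rates \<open>rE s k\<close>. The value \<open>0\<close> stands for a message that does not exist.
\<close>

definition source :: "nat \<Rightarrow> real \<Rightarrow> real \<Rightarrow> nat \<Rightarrow> real \<Rightarrow> (state \<Rightarrow> nat \<Rightarrow> real)
    \<Rightarrow> (state \<times> (nat \<Rightarrow> nat) \<times> (nat \<Rightarrow> nat)) pmf" where
  "source K \<rho> \<rho>f n RU rE =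
     bind_pmf (activity K \<rho> \<rho>f) (\<lambda>s.
     bind_pmf (Pi_pmf (urllc K s) 0 (\<lambda>_. pmf_of_set {1..num_messages n RU})) (\<lambda>mU.
     bind_pmf (Pi_pmf (embb K s) 0 (\<lambda>k. pmf_of_set {1..num_messages n (rE s k)})) (\<lambda>mE.
     return_pmf (s, mU, mE))))"


section \<open>Codes with receiver cooperation\<close>

text \<open>
  A single cooperation message is an element of \<open>nat \<Rightarrow> real\<close> with its Borel sigma-algebra
  (unlimited link capacity: any finite collection of channel outputs and earlier cooperation
  messages embeds measurably). A history assigns to \<open>(q, j)\<close> the message received in round
  \<open>q\<close> from receiver \<open>j\<close>; it is \<open>undefined\<close> where no message was received.
\<close>

type_synonym coop_msg = "nat \<Rightarrow> real"
type_synonym history = "nat \<times> nat \<Rightarrow> coop_msg"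

text \<open>
  \<open>encoder s k mU mE t\<close> is the channel input of transmitter \<open>k\<close> at time \<open>t\<close>;
  \<open>coop q j k s (y, hist)\<close> is the message from receiver \<open>j\<close> to receiver \<open>k\<close> in round \<open>q\<close>,
  where rounds are numbered \<open>0, \<dots>, rounds - 1\<close>.
\<close>

record block_code =
  encoder :: "state \<Rightarrow> nat \<Rightarrow> nat \<Rightarrow> nat \<Rightarrow> nat \<Rightarrow> real"
  urllc_decoder :: "state \<Rightarrow> nat \<Rightarrow> (nat \<Rightarrow> real) \<Rightarrow> nat"
  rounds :: nat
  coop :: "nat \<Rightarrow> nat \<Rightarrow> nat \<Rightarrow> state \<Rightarrow> (nat \<Rightarrow> real) \<times> history \<Rightarrow> coop_msg"
  embb_decoder :: "state \<Rightarrow> nat \<Rightarrow> (nat \<Rightarrow> real) \<times> history \<Rightarrow> nat"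

definition active_neighbours :: "nat \<Rightarrow> (nat \<Rightarrow> int \<times> int) \<Rightarrow> state \<Rightarrow> nat \<Rightarrow> nat set" where
  "active_neighbours K pos s k = neighbours K pos k \<inter> active K s"

definition output_space :: "nat \<Rightarrow> (nat \<Rightarrow> real) measure" where
  "output_space n = (\<Pi>\<^sub>M t\<in>{1..n}. borel)"

definition history_space ::
  "nat \<Rightarrow> (nat \<Rightarrow> int \<times> int) \<Rightarrow> state \<Rightarrow> nat \<Rightarrow> nat \<Rightarrow> history measure" where
  "history_space K pos s k r = (\<Pi>\<^sub>M i\<in>{..<r} \<times> active_neighbours K pos s k. borel)"

text \<open>
  Measurability is required because the library measure of a non-measurable error event is \<open>0\<close>.
\<close>

definition measurable_code ::
  "nat \<Rightarrow> (nat \<Rightarrow> int \<times> int) \<Rightarrow> nat \<Rightarrow> block_code \<Rightarrow> bool" where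
  "measurable_code K pos n C \<longleftrightarrow>
     (\<forall>s k. urllc_decoder C s k \<in> measurable (output_space n) (count_space UNIV)) \<and>
     (\<forall>q j k s. coop C q j k s
        \<in> measurable (output_space n \<Otimes>\<^sub>M history_space K pos s j q) borel) \<and>
     (\<forall>s k. embb_decoder C s k
        \<in> measurable (output_space n \<Otimes>\<^sub>M history_space K pos s k (rounds C)) (count_space UNIV))"

definition channel_input ::
  "nat \<Rightarrow> block_code \<Rightarrow> state \<Rightarrow> (nat \<Rightarrow> nat) \<Rightarrow> (nat \<Rightarrow> nat) \<Rightarrow> nat \<Rightarrow> nat \<Rightarrow> real" where
  "channel_input K C s mU mE k t = (if k \<in> active K s then encoder C s k (mU k) (mE k) t else 0)"

definition channel_output ::
  "nat \<Rightarrow> (nat \<Rightarrow> int \<times> int) \<Rightarrow> (nat \<Rightarrow> nat \<Rightarrow> real) \<Rightarrow> nat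
    \<Rightarrow> (nat \<Rightarrow> nat \<Rightarrow> real) \<Rightarrow> (nat \<times> nat \<Rightarrow> real) \<Rightarrow> nat \<Rightarrow> nat \<Rightarrow> real" where
  "channel_output K pos h n X z k = (\<lambda>t\<in>{1..n}.
     h k k * X k t + (\<Sum>j\<in>neighbours K pos k. h j k * X j t) + z (k, t))"

text \<open>
  \<open>received K pos C s Y r k\<close> is the history of receiver \<open>k\<close> after the first \<open>r\<close> rounds, where
  \<open>Y j\<close> is the output block of receiver \<open>j\<close>.
\<close>

primrec received :: "nat \<Rightarrow> (nat \<Rightarrow> int \<times> int) \<Rightarrow> block_code \<Rightarrow> state
    \<Rightarrow> (nat \<Rightarrow> nat \<Rightarrow> real) \<Rightarrow> nat \<Rightarrow> nat \<Rightarrow> history" where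
  "received K pos C s Y 0 = (\<lambda>k i. undefined)"
| "received K pos C s Y (Suc r) = (\<lambda>k (q, j).
     if q = r \<and> j \<in> active_neighbours K pos s k
     then coop C r j k s (Y j, received K pos C s Y r j)
     else received K pos C s Y r k (q, j))"

definition power_constraint ::
  "nat \<Rightarrow> real \<Rightarrow> real \<Rightarrow> nat \<Rightarrow> real \<Rightarrow> real \<Rightarrow> (state \<Rightarrow> nat \<Rightarrow> real) \<Rightarrow> block_code \<Rightarrow> bool" where
  "power_constraint K \<rho> \<rho>f n P RU rE C \<longleftrightarrow>
     (AE (s, mU, mE) in measure_pmf (source K \<rho> \<rho>f n RU rE).
        \<forall>k\<in>active K s. 1 / real n * (\<Sum>t=1..n. (channel_input K C s mU mE k t)\<^sup>2) \<le> P)"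

definition decoding_error ::
  "nat \<Rightarrow> (nat \<Rightarrow> int \<times> int) \<Rightarrow> (nat \<Rightarrow> nat \<Rightarrow> real) \<Rightarrow> nat \<Rightarrow> block_code
    \<Rightarrow> state \<Rightarrow> (nat \<Rightarrow> nat) \<Rightarrow> (nat \<Rightarrow> nat) \<Rightarrow> (nat \<times> nat \<Rightarrow> real) \<Rightarrow> bool" where
  "decoding_error K pos h n C s mU mE z \<longleftrightarrow>
     (let Y = channel_output K pos h n (channel_input K C s mU mE) z in
      (\<exists>k\<in>urllc K s. urllc_decoder C s k (Y k) \<noteq> mU k) \<or>
      (\<exists>k\<in>embb K s. embb_decoder C s k (Y k, received K pos C s Y (rounds C) k) \<noteq> mE k))"

definition noise :: "nat \<Rightarrow> nat \<Rightarrow> (nat \<times> nat \<Rightarrow> real) measure" where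
  "noise K n = (\<Pi>\<^sub>M i\<in>{1..K} \<times> {1..n}. std_normal_distribution)"

text \<open>The noise is independent of the source, so the error probability is an iterated one.\<close>

definition error_probability ::
  "nat \<Rightarrow> (nat \<Rightarrow> int \<times> int) \<Rightarrow> (nat \<Rightarrow> nat \<Rightarrow> real) \<Rightarrow> real \<Rightarrow> real \<Rightarrow> nat \<Rightarrow> real
    \<Rightarrow> (state \<Rightarrow> nat \<Rightarrow> real) \<Rightarrow> block_code \<Rightarrow> real" where
  "error_probability K pos h \<rho> \<rho>f n RU rE C =
     measure_pmf.expectation (source K \<rho> \<rho>f n RU rE) (\<lambda>(s, mU, mE).
       measure (noise K n) {z \<in> space (noise K n). decoding_error K pos h n C s mU mE z})"


section \<open>Achievable rates and multiplexing gains\<close>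

definition achievable_rates ::
  "nat \<Rightarrow> (nat \<Rightarrow> int \<times> int) \<Rightarrow> (nat \<Rightarrow> nat \<Rightarrow> real) \<Rightarrow> real \<Rightarrow> real \<Rightarrow> real \<Rightarrow> real \<Rightarrow> real \<Rightarrow> bool"
where
  "achievable_rates K pos h \<rho> \<rho>f P RU Rbar \<longleftrightarrow>
     0 \<le> RU \<and> 0 \<le> Rbar \<and>
     (\<exists>rE :: state \<Rightarrow> nat \<Rightarrow> real.
        (\<forall>s k. 0 \<le> rE s k) \<and>
        Rbar \<le> measure_pmf.expectation (activity K \<rho> \<rho>f)
                  (\<lambda>s. 1 / real K * (\<Sum>k\<in>embb K s. rE s k)) \<and>
        (\<exists>C :: nat \<Rightarrow> block_code.
           (\<forall>n\<ge>1. measurable_code K pos n (C n) \<and> power_constraint K \<rho> \<rho>f n P RU rE (C n)) \<and>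
           (\<lambda>n. error_probability K pos h \<rho> \<rho>f n RU rE (C n)) \<longlonglongrightarrow> 0))"

text \<open>From here on, \<open>pos K\<close> and \<open>h K\<close> are the cell positions and gains of the \<open>K\<close>-cell network.\<close>

definition achievable_MG ::
  "(nat \<Rightarrow> nat \<Rightarrow> int \<times> int) \<Rightarrow> (nat \<Rightarrow> nat \<Rightarrow> nat \<Rightarrow> real) \<Rightarrow> real \<Rightarrow> real \<Rightarrow> real \<times> real \<Rightarrow> bool"
where
  "achievable_MG pos h \<rho> \<rho>f S \<longleftrightarrow>
     (\<exists>RU Rbar :: nat \<Rightarrow> real \<Rightarrow> real.
        (\<forall>K\<ge>1. \<forall>P>0. achievable_rates K (pos K) (h K) \<rho> \<rho>f P (RU K P) (Rbar K P)) \<and>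
        ereal (fst S) = ereal (\<rho> * \<rho>f) *
          limsup (\<lambda>K. Limsup at_top (\<lambda>P. ereal (RU K P / (1 / 2 * log 2 P)))) \<and>
        ereal (snd S) =
          limsup (\<lambda>K. Limsup at_top (\<lambda>P. ereal (Rbar K P / (1 / 2 * log 2 P)))))"

definition MG_region ::
  "(nat \<Rightarrow> nat \<Rightarrow> int \<times> int) \<Rightarrow> (nat \<Rightarrow> nat \<Rightarrow> nat \<Rightarrow> real) \<Rightarrow> real \<Rightarrow> real \<Rightarrow> (real \<times> real) set"
where
  "MG_region pos h \<rho> \<rho>f = closure {S. achievable_MG pos h \<rho> \<rho>f S}"

end

theory Submission
  imports Defs
begin

text \<open>
  Colour cell \<open>k\<close> by \<open>(a_k + b_k) mod 3\<close>, so that equal colours are never adjacent and a cell has at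
  most three neighbours of each other colour. A fraction \<open>\<lambda>\<close> of the time is split evenly among
  the three colours: in the slots of colour \<open>c\<close> the URLLC cells of colour \<open>c\<close> send URLLC and
  every active cell that has no such cell in its closed neighbourhood sends eMBB; in the remaining
  slots every active cell sends eMBB. URLLC receivers then see no interference. The receivers of a
  connected component of active cells exchange all their outputs and invert the channel
  matrix of the component. A cell sends eMBB in a slot of its own colour with probability
  \<open>\<rho> (1 - \<rho>f)\<close> and in one of another colour with probability at least
  \<open>\<rho> (1 - \<rho> \<rho>f)^3\<close>, which gives \<open>L\<close>.

  Each message is carried by one Gilbert--Varshamov code on its slots over an equispaced alphabet of
  about \<open>sqrt P\<close> amplitudes with a fixed spacing. The spacing depends on \<open>K\<close> and \<open>\<epsilon>\<close> but
  not on \<open>P\<close>: it makes a symbol error so unlikely that a bounded distance decoder correcting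
  a fraction of order \<open>\<epsilon>\<close> of symbol errors fails with probability at most \<open>2^(-n)\<close>.
\<close>

section \<open>Zero forcing and codes with bounded distance decoding\<close>

definition linear_functional :: "(('a \<Rightarrow> real) \<Rightarrow> real) \<Rightarrow> bool" where
  "linear_functional f \<longleftrightarrow> (\<forall>x y c. f (\<lambda>i. x i + c * y i) = f x + c * f y)"

lemma functional_in_span:
  assumes "finite J" "\<And>j. j \<in> J \<Longrightarrow> linear_functional (f j)" "linear_functional g"
    and "\<And>x. (\<forall>j\<in>J. f j x = 0) \<Longrightarrow> g x = 0"
  shows "\<exists>c. \<forall>x. g x = (\<Sum>j\<in>J. c j * f j x)"
  using assms
proof (induction J arbitrary: g rule: finite_induct)
  case empty
  then show ?case by auto
next
  case (insert a J)
  show ?case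
  proof (cases "\<forall>x. (\<forall>j\<in>J. f j x = 0) \<longrightarrow> f a x = 0")
    case True
    then have "\<exists>c. \<forall>x. g x = (\<Sum>j\<in>J. c j * f j x)"
      using insert.prems by (intro insert.IH) auto
    then obtain c where "\<And>x. g x = (\<Sum>j\<in>J. c j * f j x)" by auto
    moreover have "(\<Sum>j\<in>insert a J. (c(a := 0)) j * f j x) = (\<Sum>j\<in>J. c j * f j x)" for x
      using insert.hyps by (auto intro!: sum.cong)
    ultimately show ?thesis by metis
  next
    case False
    then obtain v where v: "\<And>j. j \<in> J \<Longrightarrow> f j v = 0" and va: "f a v \<noteq> 0" by auto
    define b where "b = g v / f a v"
    have lin: "linear_functional (\<lambda>x. g x - b * f a x)"
      using insert.prems(1)[of a] insert.prems(2)
      by (simp add: linear_functional_def algebra_simps)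
    have "\<exists>c. \<forall>x. g x - b * f a x = (\<Sum>j\<in>J. c j * f j x)"
    proof (rule insert.IH)
      fix x assume x: "\<forall>j\<in>J. f j x = 0"
      \<comment> \<open>Moving \<open>x\<close> along \<open>v\<close> makes \<open>f a\<close>
        vanish too and keeps the other functionals at 0.\<close>
      define w where "w = (\<lambda>i. x i + (- f a x / f a v) * v i)"
      have fw: "f j w = f j x + (- f a x / f a v) * f j v" if "j \<in> insert a J" for j
        using insert.prems(1)[OF that] unfolding linear_functional_def w_def by blast
      have gw: "g w = g x + (- f a x / f a v) * g v"
        using insert.prems(2) unfolding linear_functional_def w_def by blast
      have "\<forall>j\<in>insert a J. f j w = 0"
        using fw v x va by auto
      then have "g w = 0" by (rule insert.prems(3))
      then show "g x - b * f a x = 0"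
        using gw by (simp add: b_def)
    qed (use lin insert.prems(1) in auto)
    then obtain c where c: "\<And>x. g x - b * f a x = (\<Sum>j\<in>J. c j * f j x)" by auto
    have "(\<Sum>j\<in>insert a J. (c(a := b)) j * f j x) = b * f a x + (\<Sum>j\<in>J. c j * f j x)" for x
      using insert.hyps by (auto intro!: sum.cong)
    then have "g x = (\<Sum>j\<in>insert a J. (c(a := b)) j * f j x)" for x
      using c[of x] by auto
    then show ?thesis by blast
  qed
qed

text \<open>For \<open>k\<close> in \<open>A\<close>, \<open>g\<close> is row \<open>k\<close> of
  the inverse of the channel matrix restricted to \<open>A\<close>.\<close>

definition zero_forcing :: "nat \<Rightarrow> (nat \<Rightarrow> int \<times> int) \<Rightarrow> (nat \<Rightarrow> nat \<Rightarrow> real)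
    \<Rightarrow> nat set \<Rightarrow> nat \<Rightarrow> (nat \<Rightarrow> real) \<Rightarrow> bool" where
  "zero_forcing K pos h A k g \<longleftrightarrow> (\<forall>x. x k =
     (\<Sum>l\<in>A. g l * (h l l * x l + (\<Sum>j\<in>neighbours K pos l \<inter> A. h j l * x j))))"

text \<open>Nonsingularity makes the coordinate \<open>x k\<close> vanish wherever all noiseless
  outputs in \<open>A\<close> do, so it lies in their span.\<close>

lemma zero_forcing_filter_exists:
  assumes ns: "nonsingular_channels K pos h" and A: "A \<subseteq> {1..K}" and k: "k \<in> A"
  shows "\<exists>g. zero_forcing K pos h A k g"
proof -
  have fin: "finite A" using A finite_subset by blast
  show ?thesis
    unfolding zero_forcing_def
  proof (rule functional_in_span[OF fin])
    show "linear_functional (\<lambda>x. h l l * x l + (\<Sum>j\<in>neighbours K pos l \<inter> A. h j l * x j))" for l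
      by (simp add: linear_functional_def algebra_simps sum.distrib sum_distrib_left)
    show "linear_functional (\<lambda>x. x k)" by (simp add: linear_functional_def)
    show "x k = 0"
      if "\<forall>l\<in>A. h l l * x l + (\<Sum>j\<in>neighbours K pos l \<inter> A. h j l * x j) = 0" for x
      using ns A k that unfolding nonsingular_channels_def by blast
  qed
qed

section \<open>Gilbert-Varshamov codes\<close>

lemma card_hamming_ball_le:
  assumes T: "finite T" and w: "w \<in> T \<rightarrow>\<^sub>E {..<q}" and q: "0 < q"
  shows "card {v \<in> T \<rightarrow>\<^sub>E {..<q}. card {t\<in>T. v t \<noteq> w t} \<le> d} \<le> 2 ^ card T * q ^ d"
    (is "card ?B \<le> _")
proof -
  \<comment> \<open>A word of the ball is fixed by the set \<open>S\<close> of positions where it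
    leaves \<open>w\<close> and by its symbols there: at most \<open>2 ^ card T\<close> sets with at
    most \<open>q ^ d\<close> fillings each. The crude count of sets costs one bit per slot,
    negligible against \<open>log 2 q\<close> at high power.\<close>
  define F where "F S = (\<lambda>g t. if t \<in> S then g t else w t) ` (S \<rightarrow>\<^sub>E {..<q})" for S
  let ?I = "{S. S \<subseteq> T \<and> card S \<le> d}"
  have finS: "finite S" if "S \<in> ?I" for S using that T finite_subset by blast
  have "?B \<subseteq> (\<Union>S\<in>?I. F S)"
  proof
    fix v assume v: "v \<in> ?B"
    let ?S = "{t\<in>T. v t \<noteq> w t}"
    have "v = (\<lambda>t. if t \<in> ?S then (restrict v ?S) t else w t)"
    proof
      fix t show "v t = (if t \<in> ?S then (restrict v ?S) t else w t)"
        using v w by (cases "t \<in> T") (auto simp: PiE_def extensional_def)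
    qed
    moreover have "restrict v ?S \<in> ?S \<rightarrow>\<^sub>E {..<q}" using v by auto
    ultimately have "v \<in> F ?S" unfolding F_def by blast
    then show "v \<in> (\<Union>S\<in>?I. F S)" using v by (intro UN_I[of ?S]) auto
  qed
  moreover have finI: "finite ?I" using T by simp
  moreover have finF: "finite (F S)" if "S \<in> ?I" for S
    unfolding F_def using finS[OF that] by (intro finite_imageI finite_PiE) auto
  ultimately have "card ?B \<le> card (\<Union>S\<in>?I. F S)" by (intro card_mono) auto
  also have "\<dots> \<le> (\<Sum>S\<in>?I. card (F S))" by (rule card_UN_le[OF finI])
  also have "\<dots> \<le> (\<Sum>S\<in>?I. q ^ d)"
  proof (rule sum_mono)
    fix S assume S: "S \<in> ?I"
    have "card (F S) \<le> card (S \<rightarrow>\<^sub>E {..<q})"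
      unfolding F_def using finS[OF S] by (intro card_image_le finite_PiE) auto
    also have "\<dots> = q ^ card S" using finS[OF S] by (simp add: card_PiE)
    also have "\<dots> \<le> q ^ d" using S q by (intro power_increasing) auto
    finally show "card (F S) \<le> q ^ d" .
  qed
  also have "\<dots> = card ?I * q ^ d" by simp
  also have "\<dots> \<le> 2 ^ card T * q ^ d"
  proof -
    have "card ?I \<le> card (Pow T)" using T by (intro card_mono) auto
    then show ?thesis using T by (simp add: card_Pow)
  qed
  finally show ?thesis .
qed

text \<open>Used with \<open>d = 2 * r\<close>, where it makes the Hamming balls of radius
  \<open>r\<close> about the codewords disjoint.\<close>

definition separated_code :: "nat set \<Rightarrow> nat \<Rightarrow> nat \<Rightarrow> (nat \<Rightarrow> nat \<Rightarrow> nat) \<Rightarrow> bool" where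
  "separated_code T d M c \<longleftrightarrow>
     (\<forall>m\<in>{1..M}. \<forall>m'\<in>{1..M}. m \<noteq> m' \<longrightarrow> d < card {t\<in>T. c m t \<noteq> c m' t})"

text \<open>Greedy choice: while the balls of radius \<open>d\<close> about the words chosen so far
  cannot cover the word space, a further word lies outside all of them. Only the
  \<open>M - 1\<close> balls that precede the last word are counted.\<close>

lemma gilbert_varshamov_words:
  assumes T: "finite T" and q: "0 < q" and M: "(M - 1) * (2 ^ card T * q ^ d) < q ^ card T"
  shows "\<exists>c. (\<forall>m\<in>{1..M}. c m \<in> T \<rightarrow>\<^sub>E {..<q}) \<and> separated_code T d M c"
  using M
proof (induction M)
  case 0
  show ?case by (auto simp: separated_code_def)
next
  case (Suc M)
  have "(M - 1) * (2 ^ card T * q ^ d) \<le> (Suc M - 1) * (2 ^ card T * q ^ d)"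
    by (intro mult_right_mono) auto
  then obtain c where c: "\<And>m. m \<in> {1..M} \<Longrightarrow> c m \<in> T \<rightarrow>\<^sub>E {..<q}" and sep: "separated_code T d M c"
    using Suc by (meson le_less_trans)
  define B where "B m = {v \<in> T \<rightarrow>\<^sub>E {..<q}. card {t\<in>T. v t \<noteq> c m t} \<le> d}" for m
  have "card (\<Union>m\<in>{1..M}. B m) \<le> (\<Sum>m\<in>{1..M}. card (B m))" by (rule card_UN_le) auto
  also have "\<dots> \<le> (\<Sum>m\<in>{1..M}. 2 ^ card T * q ^ d)"
    unfolding B_def using card_hamming_ball_le[OF T c q] by (intro sum_mono) blast
  also have "\<dots> < card (T \<rightarrow>\<^sub>E {..<q})" using Suc.prems T by (simp add: card_PiE)
  finally have less: "card (\<Union>m\<in>{1..M}. B m) < card (T \<rightarrow>\<^sub>E {..<q})" .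
  have "finite (B m)" for m unfolding B_def using T by (simp add: finite_PiE)
  then have "finite (\<Union>m\<in>{1..M}. B m)" by simp
  with less have "\<not> (T \<rightarrow>\<^sub>E {..<q}) \<subseteq> (\<Union>m\<in>{1..M}. B m)"
    using card_mono linorder_not_le by blast
  then obtain w where w: "w \<in> T \<rightarrow>\<^sub>E {..<q}" "\<And>m. m \<in> {1..M} \<Longrightarrow> w \<notin> B m" by blast
  have far: "d < card {t\<in>T. w t \<noteq> c m t}" if "m \<in> {1..M}" for m
    using w(1) w(2)[OF that] unfolding B_def by (simp add: not_le)
  then have far': "d < card {t\<in>T. c m t \<noteq> w t}" if "m \<in> {1..M}" for m
    using far[OF that] by (simp only: eq_commute[of "c m t" "w t" for t])
  have step: "m = Suc M \<or> m \<in> {1..M}" if "m \<in> {1..Suc M}" for m using that by auto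
  show ?case
  proof (intro exI[of _ "c(Suc M := w)"] conjI)
    show "\<forall>m\<in>{1..Suc M}. (c(Suc M := w)) m \<in> T \<rightarrow>\<^sub>E {..<q}"
      using c w(1) step by (metis fun_upd_apply)
    have "d < card {t\<in>T. (c(Suc M := w)) m t \<noteq> (c(Suc M := w)) m' t}"
      if "m \<in> {1..Suc M}" "m' \<in> {1..Suc M}" "m \<noteq> m'" for m m'
    proof -
      show ?thesis
      proof (cases "m = Suc M")
        case True
        then have "m' \<in> {1..M}" using step[OF that(2)] that(3) by simp
        then show ?thesis using True that(3) far[of m'] by simp
      next
        case m: False
        then have mM: "m \<in> {1..M}" using step[OF that(1)] by simp
        show ?thesis
        proof (cases "m' = Suc M")
          case True
          then show ?thesis using m mM far'[of m] by simp
        next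
          case False
          then have "m' \<in> {1..M}" using step[OF that(2)] by simp
          then show ?thesis using m mM False that(3) sep by (simp add: separated_code_def)
        qed
      qed
    qed
    then show "separated_code T d (Suc M) (c(Suc M := w))"
      unfolding separated_code_def by blast
  qed
qed

text \<open>A total version: symbols stay below \<open>q\<close> for every index, even if the
  counting condition fails, so amplitudes can be bounded whether or not the code is
  separated.\<close>

lemma gilbert_varshamov:
  assumes T: "finite T" and q: "0 < q"
  shows "\<exists>c. (\<forall>m t. c m t < q) \<and>
    ((M - 1) * (2 ^ card T * q ^ d) < q ^ card T \<longrightarrow> separated_code T d M c)"
proof (cases "(M - 1) * (2 ^ card T * q ^ d) < q ^ card T")
  case True
  obtain c where c: "\<And>m. m \<in> {1..M} \<Longrightarrow> c m \<in> T \<rightarrow>\<^sub>E {..<q}" and sep: "separated_code T d M c"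
    using gilbert_varshamov_words[OF T q True] by blast
  define c' where "c' m t = (if m \<in> {1..M} \<and> t \<in> T then c m t else 0)" for m t
  have "{t\<in>T. c' m t \<noteq> c' m' t} = {t\<in>T. c m t \<noteq> c m' t}" if "m \<in> {1..M}" "m' \<in> {1..M}" for m m'
    using that by (auto simp: c'_def)
  then have "separated_code T d M c'" using sep by (simp add: separated_code_def)
  moreover have "c' m t < q" for m t
  proof (cases "m \<in> {1..M} \<and> t \<in> T")
    case True
    then show ?thesis using c[of m] by (auto simp: c'_def)
  qed (use q in \<open>auto simp: c'_def\<close>)
  ultimately show ?thesis by blast
next
  case False
  then show ?thesis using q by (intro exI[of _ "\<lambda>_ _. 0"]) auto
qed

section \<open>Bounded distance decoding\<close>

definition nearby_message ::
  "nat set \<Rightarrow> nat \<Rightarrow> real \<Rightarrow> (nat \<Rightarrow> nat \<Rightarrow> nat) \<Rightarrow> nat \<Rightarrow> (nat \<Rightarrow> real) \<Rightarrow> nat \<Rightarrow> bool" where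
  "nearby_message T r \<Delta> c M e m \<longleftrightarrow> m \<in> {1..M} \<and>
     (\<exists>S\<in>Pow T. card S \<le> r \<and> (\<forall>t\<in>T - S. \<bar>e t - \<Delta> * real (c m t)\<bar> < \<Delta> / 2))"

definition bounded_distance_decoder ::
  "nat set \<Rightarrow> nat \<Rightarrow> real \<Rightarrow> (nat \<Rightarrow> nat \<Rightarrow> nat) \<Rightarrow> nat \<Rightarrow> (nat \<Rightarrow> real) \<Rightarrow> nat" where
  "bounded_distance_decoder T r \<Delta> c M e = (LEAST m. nearby_message T r \<Delta> c M e m)"

text \<open>The true message is nearby, with its at most \<open>r\<close> bad slots as
  \<open>S\<close>. For two nearby messages, off the at most \<open>2 * r\<close> slots excluded for
  either, both scaled codewords are within \<open>\<Delta> / 2\<close> of \<open>e\<close>; their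
  symbols are then equal integers, against the separation. So \<open>LEAST\<close> picks from a
  single candidate.\<close>

lemma bounded_distance_decoder_correct:
  assumes T: "finite T" and \<Delta>: "0 < \<Delta>" and sep: "separated_code T (2 * r) M c"
    and m: "m \<in> {1..M}" and r: "card {t\<in>T. \<Delta> / 2 \<le> \<bar>e t - \<Delta> * real (c m t)\<bar>} \<le> r"
  shows "bounded_distance_decoder T r \<Delta> c M e = m"
proof -
  have near: "nearby_message T r \<Delta> c M e m"
    unfolding nearby_message_def
    by (intro conjI m bexI[of _ "{t\<in>T. \<Delta> / 2 \<le> \<bar>e t - \<Delta> * real (c m t)\<bar>}"] r) auto
  have uniq: "m' = m" if near': "nearby_message T r \<Delta> c M e m'" for m'
  proof (rule ccontr)
    assume ne: "m' \<noteq> m"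
    obtain S where S: "S \<subseteq> T" "card S \<le> r"
      "\<And>t. t \<in> T - S \<Longrightarrow> \<bar>e t - \<Delta> * real (c m t)\<bar> < \<Delta> / 2"
      using near unfolding nearby_message_def by blast
    obtain S' where S': "S' \<subseteq> T" "card S' \<le> r"
      "\<And>t. t \<in> T - S' \<Longrightarrow> \<bar>e t - \<Delta> * real (c m' t)\<bar> < \<Delta> / 2"
      using near' unfolding nearby_message_def by blast
    have "c m' t = c m t" if t: "t \<in> T - (S \<union> S')" for t
    proof -
      have "\<bar>\<Delta> * real (c m' t) - \<Delta> * real (c m t)\<bar> < \<Delta>"
        using S(3)[of t] S'(3)[of t] t unfolding abs_less_iff by auto
      then have "\<Delta> * \<bar>real (c m' t) - real (c m t)\<bar> < \<Delta> * 1"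
        using \<Delta> by (simp add: abs_mult flip: right_diff_distrib)
      then have "\<bar>real (c m' t) - real (c m t)\<bar> < 1"
        using \<Delta> mult_less_cancel_left_pos by blast
      then show ?thesis by linarith
    qed
    then have "{t\<in>T. c m' t \<noteq> c m t} \<subseteq> S \<union> S'" by blast
    moreover have "finite (S \<union> S')" using S(1) S'(1) T finite_subset by blast
    ultimately have "card {t\<in>T. c m' t \<noteq> c m t} \<le> card S + card S'"
      by (meson card_Un_le card_mono le_trans)
    moreover have "2 * r < card {t\<in>T. c m' t \<noteq> c m t}"
      using sep near near' ne unfolding separated_code_def nearby_message_def by blast
    ultimately show False using S(2) S'(2) by linarith
  qed
  have least: "m \<le> m'" if "nearby_message T r \<Delta> c M e m'" for m'
    using uniq[OF that] by simp
  show ?thesis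
    unfolding bounded_distance_decoder_def
    by (rule Least_equality) (fact near, fact least)
qed

text \<open>The exceptional slots in \<open>nearby_message\<close> range over the finite set
  \<open>Pow T\<close>, which leaves a finite combination of measurable comparisons.\<close>

lemma measurable_bounded_distance_decoder:
  assumes T: "finite T" and e: "\<And>t. t \<in> T \<Longrightarrow> (\<lambda>x. e x t) \<in> borel_measurable N"
  shows "(\<lambda>x. bounded_distance_decoder T r \<Delta> c M (e x)) \<in> measurable N (count_space UNIV)"
proof -
  have near: "Measurable.pred N (\<lambda>x. \<bar>e x t - a\<bar> < b)" if "t \<in> T" for t a b
    using e[OF that] by measurable
  have "Measurable.pred N (\<lambda>x. nearby_message T r \<Delta> c M (e x) m)" for m
    unfolding nearby_message_def using T
    by (intro pred_intros_logic pred_intros_finite near) (auto intro: finite_subset)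
  then show ?thesis
    unfolding bounded_distance_decoder_def by (rule measurable_Least)
qed

section \<open>Exceedances of Gaussian noise\<close>

lemma prob_space_std_normal: "prob_space std_normal_distribution"
  using real_dist_normal_dist unfolding real_distribution_def by blast

text \<open>Continuity from above along the integer thresholds, whose exceedance sets have empty
  intersection, takes the place of a Gaussian tail estimate.\<close>

lemma normal_tail_small:
  assumes "0 < \<delta>"
  shows "\<exists>\<tau>\<ge>0. measure std_normal_distribution {x. \<tau> < \<bar>x\<bar>} < \<delta>"
proof -
  interpret prob_space std_normal_distribution by (rule prob_space_std_normal)
  define B where "B i = {x :: real. real i < \<bar>x\<bar>}" for i
  have "B i \<in> sets borel" for i unfolding B_def by measurable
  then have "range B \<subseteq> events" by auto
  moreover have "decseq B" unfolding B_def decseq_def by auto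
  ultimately have lim: "(\<lambda>i. prob (B i)) \<longlonglongrightarrow> prob (\<Inter>i. B i)"
    by (rule finite_Lim_measure_decseq)
  have "(\<Inter>i. B i) = {}"
  proof -
    have "x \<notin> (\<Inter>i. B i)" for x
      using reals_Archimedean2[of "\<bar>x\<bar>"] unfolding B_def by (auto dest: less_imp_not_less)
    then show ?thesis by blast
  qed
  then have "(\<lambda>i. prob (B i)) \<longlonglongrightarrow> 0" using lim by simp
  then have "eventually (\<lambda>i. prob (B i) < \<delta>) sequentially"
    using assms order_tendstoD(2) by blast
  then obtain i where "prob (B i) < \<delta>" by (auto simp: eventually_sequentially)
  then show ?thesis unfolding B_def by (intro exI[of _ "real i"]) auto
qed

text \<open>Union bound over the sets of \<open>r + 1\<close> coordinates that may all exceed \<open>\<tau>\<close>.\<close>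

lemma exceedance_event:
  fixes I :: "'i set" and \<tau> :: real and r :: nat
  defines "D \<equiv> std_normal_distribution"
  defines "E \<equiv> {z \<in> space (\<Pi>\<^sub>M i\<in>I. D). r < card {i\<in>I. \<tau> < \<bar>z i\<bar>}}"
  assumes I: "finite I"
  shows "E \<in> sets (\<Pi>\<^sub>M i\<in>I. D)"
    and "measure (\<Pi>\<^sub>M i\<in>I. D) E \<le> 2 ^ card I * measure D {x. \<tau> < \<bar>x\<bar>} ^ Suc r"
proof -
  interpret D: prob_space D unfolding D_def by (rule prob_space_std_normal)
  interpret finite_product_prob_space "\<lambda>_. D" I by unfold_locales (fact I)
  define p where "p = measure D {x. \<tau> < \<bar>x\<bar>}"
  \<comment> \<open>In the box of \<open>S\<close> the coordinates in \<open>S\<close> exceed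
    \<open>\<tau>\<close> and the others are free, so by independence its probability is
    \<open>p ^ card S\<close>.\<close>
  define V where "V S i = (if i \<in> S then {x :: real. \<tau> < \<bar>x\<bar>} else UNIV)" for S and i :: 'i
  let ?J = "{S. S \<subseteq> I \<and> card S = Suc r}"
  have V: "V S i \<in> sets D" for S i unfolding V_def D_def by auto
  have finJ: "finite ?J" using I by simp
  have box: "(\<Pi>\<^sub>E i\<in>I. V S i) \<in> sets (\<Pi>\<^sub>M i\<in>I. D)" for S
    using I V by (intro sets_PiM_I_finite) auto
  have E: "E = (\<Union>S\<in>?J. \<Pi>\<^sub>E i\<in>I. V S i)"
  proof (intro equalityI subsetI)
    fix z assume z: "z \<in> E"
    then have "Suc r \<le> card {i\<in>I. \<tau> < \<bar>z i\<bar>}" unfolding E_def by simp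
    then obtain S where S: "S \<subseteq> {i\<in>I. \<tau> < \<bar>z i\<bar>}" "card S = Suc r"
      by (rule obtain_subset_with_card_n)
    moreover have "z \<in> (\<Pi>\<^sub>E i\<in>I. V S i)"
      using z S(1) unfolding E_def V_def D_def by (auto simp: space_PiM PiE_def)
    ultimately show "z \<in> (\<Union>S\<in>?J. \<Pi>\<^sub>E i\<in>I. V S i)" by blast
  next
    fix z assume "z \<in> (\<Union>S\<in>?J. \<Pi>\<^sub>E i\<in>I. V S i)"
    then obtain S where S: "S \<subseteq> I" "card S = Suc r" and z: "z \<in> (\<Pi>\<^sub>E i\<in>I. V S i)" by auto
    have "S \<subseteq> {i\<in>I. \<tau> < \<bar>z i\<bar>}"
    proof
      fix i assume "i \<in> S"
      then show "i \<in> {i\<in>I. \<tau> < \<bar>z i\<bar>}" using PiE_mem[OF z, of i] S(1) by (auto simp: V_def)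
    qed
    then have "Suc r \<le> card {i\<in>I. \<tau> < \<bar>z i\<bar>}"
      using I S(2) by (metis (no_types, lifting) card_mono finite_subset mem_Collect_eq subsetI)
    then show "z \<in> E" using z unfolding E_def D_def by (auto simp: space_PiM PiE_def)
  qed
  show "E \<in> sets (\<Pi>\<^sub>M i\<in>I. D)"
    unfolding E using finJ box by (intro sets.finite_UN) auto
  have boxm: "measure (\<Pi>\<^sub>M i\<in>I. D) (\<Pi>\<^sub>E i\<in>I. V S i) = p ^ Suc r" if S: "S \<in> ?J" for S
  proof -
    have "measure (\<Pi>\<^sub>M i\<in>I. D) (\<Pi>\<^sub>E i\<in>I. V S i) = (\<Prod>i\<in>I. measure D (V S i))"
      using V by (intro prob_times) auto
    also have "\<dots> = (\<Prod>i\<in>I. if i \<in> S then p else 1)"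
      using D.prob_space by (intro prod.cong) (auto simp: V_def p_def D_def)
    also have "\<dots> = p ^ card S"
      using I S by (simp add: prod.If_cases Int_absorb1)
    finally show ?thesis using S by simp
  qed
  have "measure (\<Pi>\<^sub>M i\<in>I. D) E \<le> (\<Sum>S\<in>?J. measure (\<Pi>\<^sub>M i\<in>I. D) (\<Pi>\<^sub>E i\<in>I. V S i))"
    unfolding E using finJ box by (intro finite_measure_subadditive_finite) auto
  also have "\<dots> = real (card ?J) * p ^ Suc r" using boxm by simp
  also have "\<dots> \<le> 2 ^ card I * p ^ Suc r"
  proof (intro mult_right_mono)
    have "card ?J \<le> card (Pow I)" using I by (intro card_mono) auto
    then have "real (card ?J) \<le> real (2 ^ card I)" using I by (simp only: card_Pow of_nat_le_iff)
    then show "real (card ?J) \<le> 2 ^ card I" by simp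
  qed (simp add: p_def)
  finally show "measure (\<Pi>\<^sub>M i\<in>I. D) E \<le> 2 ^ card I * measure D {x. \<tau> < \<bar>x\<bar>} ^ Suc r"
    unfolding p_def .
qed

text \<open>At most \<open>2 ^ (K * n)\<close> sets of noise samples compete, and one of size
  \<open>Suc (n div N)\<close> exceeds throughout with probability at most
  \<open>(1/2) ^ (Suc K * n)\<close>. The \<open>Suc K\<close> in the hypothesis leaves the factor
  \<open>(1/2) ^ n\<close>.\<close>

lemma noise_exceedance:
  assumes N: "0 < N" and \<tau>: "measure std_normal_distribution {x. \<tau> < \<bar>x\<bar>} \<le> (1/2) ^ (Suc K * N)"
  shows "measure (noise K n) {z \<in> space (noise K n).
           n div N < card {i \<in> {1..K} \<times> {1..n}. \<tau> < \<bar>z i\<bar>}} \<le> (1/2) ^ n" (is "?m \<le> _")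
proof -
  let ?p = "measure std_normal_distribution {x. \<tau> < \<bar>x\<bar>}"
  \<comment> \<open>\<open>N * (n div N)\<close> may fall short of \<open>n\<close>; the one
    additional exceedance makes up for the rounding.\<close>
  have n: "n \<le> N * Suc (n div N)"
    using N by (metis dividend_less_times_div less_imp_le mult_Suc_right)
  have "?m \<le> 2 ^ card ({1..K} \<times> {1..n}) * ?p ^ Suc (n div N)"
    unfolding noise_def by (rule exceedance_event(2)) auto
  also have "\<dots> = 2 ^ (K * n) * ?p ^ Suc (n div N)" by simp
  also have "\<dots> \<le> 2 ^ (K * n) * ((1/2) ^ (Suc K * N)) ^ Suc (n div N)"
    using \<tau> by (intro mult_left_mono power_mono) auto
  also have "((1/2 :: real) ^ (Suc K * N)) ^ Suc (n div N) = (1/2) ^ (Suc K * (N * Suc (n div N)))"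
    by (simp only: power_mult mult.assoc)
  also have "2 ^ (K * n) * (1/2 :: real) ^ (Suc K * (N * Suc (n div N)))
      \<le> 2 ^ (K * n) * (1/2) ^ (Suc K * n)"
    using n by (intro mult_left_mono power_decreasing mult_le_mono2) auto
  also have "\<dots> = (2 * (1/2)) ^ (K * n) * (1/2) ^ n"
    unfolding mult_Suc power_add power_mult_distrib by simp
  finally show ?thesis by simp
qed

section \<open>Flooding of channel outputs\<close>

text \<open>Only the end of an edge has to be active. From an active cell only active cells are
  reached, so its \<open>component\<close> is the connected component of active cells.\<close>

definition activity_graph :: "nat \<Rightarrow> (nat \<Rightarrow> int \<times> int) \<Rightarrow> state \<Rightarrow> (nat \<times> nat) set" where
  "activity_graph K pos s = {(i, j). i \<in> {1..K} \<and> j \<in> active_neighbours K pos s i}"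

text \<open>The cells whose outputs receiver \<open>j\<close> can know after \<open>q\<close> rounds
  of forwarding.\<close>

definition hop_ball :: "nat \<Rightarrow> (nat \<Rightarrow> int \<times> int) \<Rightarrow> state \<Rightarrow> nat \<Rightarrow> nat \<Rightarrow> nat set" where
  "hop_ball K pos s q j = {l. \<exists>m\<le>q. (j, l) \<in> activity_graph K pos s ^^ m}"

definition component :: "nat \<Rightarrow> (nat \<Rightarrow> int \<times> int) \<Rightarrow> state \<Rightarrow> nat \<Rightarrow> nat set" where
  "component K pos s k = {l. (k, l) \<in> (activity_graph K pos s)\<^sup>*}"

lemma activity_graph_subset: "activity_graph K pos s \<subseteq> {1..K} \<times> {1..K}"
proof
  fix e assume "e \<in> activity_graph K pos s"
  then show "e \<in> {1..K} \<times> {1..K}"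
    by (cases e) (simp add: activity_graph_def active_neighbours_def neighbours_def)
qed

text \<open>Reachability takes no more hops than there are edges, and there are at most
  \<open>K * K\<close> of them; hence the number of rounds of the scheme.\<close>

lemma component_eq_hop_ball: "component K pos s k = hop_ball K pos s (K * K) k"
proof -
  let ?E = "activity_graph K pos s"
  have fin: "finite ?E" by (rule finite_subset[OF activity_graph_subset]) simp
  have card: "card ?E \<le> K * K"
    using card_mono[OF _ activity_graph_subset[of K pos s]] by (simp add: card_cartesian_product)
  have star: "?E\<^sup>* = (\<Union>m\<in>{m. m \<le> card ?E}. ?E ^^ m)" using fin by (rule rtrancl_finite_eq_relpow)
  show ?thesis
  proof (intro equalityI subsetI)
    fix l assume "l \<in> component K pos s k"
    then have "(k, l) \<in> (\<Union>m\<in>{m. m \<le> card ?E}. ?E ^^ m)"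
      unfolding component_def star[symmetric] by simp
    then obtain m where m: "m \<le> card ?E" "(k, l) \<in> ?E ^^ m" by auto
    have "m \<le> K * K" using m(1) card by (rule le_trans)
    with m(2) show "l \<in> hop_ball K pos s (K * K) k" unfolding hop_ball_def by blast
  next
    fix l assume "l \<in> hop_ball K pos s (K * K) k"
    then obtain m where "(k, l) \<in> ?E ^^ m" unfolding hop_ball_def by auto
    then show "l \<in> component K pos s k" unfolding component_def by (simp add: relpow_imp_rtrancl)
  qed
qed

lemma self_in_component: "k \<in> component K pos s k"
  unfolding component_def by simp

lemma component_subset: "component K pos s k \<subseteq> {1..K}" if "k \<in> {1..K}"
proof
  fix l assume "l \<in> component K pos s k"
  then have "(k, l) \<in> (activity_graph K pos s)\<^sup>*" unfolding component_def by simp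
  then show "l \<in> {1..K}"
    by (induction rule: rtrancl_induct) (use that activity_graph_subset[of K pos s] in auto)
qed

text \<open>A neighbour outside the component is therefore inactive, and no interference enters the
  component from outside.\<close>

lemma component_closed:
  assumes "k \<in> {1..K}" "l \<in> component K pos s k" "j \<in> neighbours K pos l" "j \<in> active K s"
  shows "j \<in> component K pos s k"
proof -
  have "(l, j) \<in> activity_graph K pos s"
    using assms subsetD[OF component_subset[OF assms(1)] assms(2)]
    by (simp add: activity_graph_def active_neighbours_def)
  then show ?thesis using assms(2) unfolding component_def by (auto intro: rtrancl_into_rtrancl)
qed

text \<open>
  Entry \<open>prod_encode (l, t)\<close> of a relayed message is the output of receiver \<open>l\<close> at time \<open>t\<close>.
\<close>

definition relay :: "nat \<Rightarrow> nat \<Rightarrow> (nat \<Rightarrow> int \<times> int) \<Rightarrow> state \<Rightarrow> nat \<Rightarrow> nat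
    \<Rightarrow> (nat \<Rightarrow> real) \<times> history \<Rightarrow> coop_msg" where
  "relay n K pos s q j x = (\<lambda>i.
     let l = fst (prod_decode i); t = snd (prod_decode i);
         S = {p \<in> active_neighbours K pos s j. 0 < q \<and> l \<in> hop_ball K pos s (q - 1) p}
     in if l = j then (if t \<in> {1..n} then fst x t else 0)
        else if S = {} then 0
        else snd x (q - 1, SOME p. p \<in> S) i)"

text \<open>Induction on the round: what \<open>j\<close> forwards about another cell
  \<open>l\<close> it copies from the previous message of an active neighbour that already knew
  \<open>l\<close>. For \<open>q\<close> equal to the number of rounds this is the message
  \<open>j\<close> would send next, which the eMBB decoder uses as a summary of its history.\<close>

lemma relay_correct:
  assumes C: "coop C = (\<lambda>q j k s. relay n K pos s q j)"
  shows "\<lbrakk>j \<in> {1..K}; l \<in> hop_ball K pos s q j; t \<in> {1..n}\<rbrakk> \<Longrightarrow>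
    relay n K pos s q j (Y j, received K pos C s Y q j) (prod_encode (l, t)) = Y l t"
proof (induction q arbitrary: j)
  case 0
  then show ?case by (simp add: relay_def hop_ball_def)
next
  case (Suc q)
  show ?case
  proof (cases "l = j")
    case True
    then show ?thesis using Suc.prems by (simp add: relay_def)
  next
    case False
    define S where "S = {p \<in> active_neighbours K pos s j. 0 < Suc q \<and> l \<in> hop_ball K pos s (Suc q - 1) p}"
    obtain m where m: "m \<le> Suc q" "(j, l) \<in> activity_graph K pos s ^^ m"
      using Suc.prems(2) unfolding hop_ball_def by auto
    then obtain m' where m': "m = Suc m'" using False by (cases m) auto
    \<comment> \<open>The first hop of a path to \<open>l\<close> leads to an active neighbour with
      \<open>l\<close> in its smaller ball, so the choice in \<open>relay\<close> is from a nonempty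
      set.\<close>
    obtain p where "(j, p) \<in> activity_graph K pos s" "(p, l) \<in> activity_graph K pos s ^^ m'"
      using m(2) unfolding m' by (meson relpow_Suc_D2)
    then have "p \<in> S"
      using m(1) m' unfolding S_def hop_ball_def activity_graph_def by auto
    then have ne: "S \<noteq> {}" and some: "(SOME p. p \<in> S) \<in> S" by (auto intro: someI)
    define p' where "p' = (SOME p. p \<in> S)"
    have p': "p' \<in> active_neighbours K pos s j" "l \<in> hop_ball K pos s q p'"
      using some unfolding p'_def[symmetric] by (simp_all add: S_def)
    then have "p' \<in> {1..K}" unfolding active_neighbours_def neighbours_def by auto
    have "relay n K pos s (Suc q) j (Y j, received K pos C s Y (Suc q) j) (prod_encode (l, t))
        = received K pos C s Y (Suc q) j (q, p') (prod_encode (l, t))"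
      unfolding relay_def Let_def prod_encode_inverse fst_conv snd_conv S_def[symmetric] p'_def
      using False ne by simp
    also have "\<dots> = relay n K pos s q p' (Y p', received K pos C s Y q p') (prod_encode (l, t))"
      using p' C by simp
    also have "\<dots> = Y l t"
      using Suc.IH[OF \<open>p' \<in> {1..K}\<close> p'(2) Suc.prems(3)] .
    finally show ?thesis .
  qed
qed

lemma measurable_output: "t \<in> {1..n} \<Longrightarrow> (\<lambda>y. y t) \<in> borel_measurable (output_space n)"
  unfolding output_space_def by (rule measurable_component_singleton)

lemma measurable_relay:
  "relay n K pos s q j \<in> measurable (output_space n \<Otimes>\<^sub>M history_space K pos s j q) borel"
proof (rule measurable_coordinatewise_then_product)
  fix i
  let ?N = "output_space n \<Otimes>\<^sub>M history_space K pos s j q"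
  define l t where "l = fst (prod_decode i)" and "t = snd (prod_decode i)"
  define S where "S = {p \<in> active_neighbours K pos s j. 0 < q \<and> l \<in> hop_ball K pos s (q - 1) p}"
  have eq: "relay n K pos s q j x i = (if l = j then (if t \<in> {1..n} then fst x t else 0)
        else if S = {} then 0 else snd x (q - 1, SOME p. p \<in> S) i)" for x
    unfolding relay_def l_def t_def S_def Let_def ..
  have "(\<lambda>x. fst x t) \<in> borel_measurable ?N" if "t \<in> {1..n}"
    using measurable_compose[OF measurable_fst measurable_output[OF that]] .
  moreover have "(\<lambda>x. snd x (q - 1, SOME p. p \<in> S) i) \<in> borel_measurable ?N" if "S \<noteq> {}"
  proof -
    \<comment> \<open>Nonemptiness places the chosen entry among the coordinates of
      \<open>history_space\<close>; the default 0 in \<open>relay\<close> covers the other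
      case.\<close>
    have "(SOME p. p \<in> S) \<in> S" using that by (auto intro: someI)
    then have "(q - 1, SOME p. p \<in> S) \<in> {..<q} \<times> active_neighbours K pos s j"
      unfolding S_def by auto
    then have "(\<lambda>hist. hist (q - 1, SOME p. p \<in> S)) \<in> measurable (history_space K pos s j q) borel"
      unfolding history_space_def by (rule measurable_component_singleton)
    then have "(\<lambda>x. snd x (q - 1, SOME p. p \<in> S)) \<in> measurable ?N borel"
      by (rule measurable_compose[OF measurable_snd])
    then show ?thesis by (rule measurable_compose) (rule measurable_product_coordinates)
  qed
  ultimately show "(\<lambda>x. relay n K pos s q j x i) \<in> borel_measurable ?N"
    unfolding eq by (cases "l = j"; cases "t \<in> {1..n}"; cases "S = {}") (simp_all del: atLeastAtMost_iff)
qed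

section \<open>The slotted scheme\<close>

text \<open>One block length and one power. By \<open>filter_gain\<close> a slot is decided
  correctly when all its noise samples are at most \<open>\<tau>\<close> in absolute value. Silence
  (\<open>quiet\<close>) is imposed only around URLLC receivers, which decode before cooperation;
  interference among eMBB signals is inverted instead.\<close>

locale slotted_scheme =
  fixes K :: nat and pos :: "nat \<Rightarrow> int \<times> int" and h :: "nat \<Rightarrow> nat \<Rightarrow> real"
    and n r :: nat and \<Delta> \<tau> :: real and G :: "nat set \<Rightarrow> nat \<Rightarrow> nat \<Rightarrow> real"
    and TU TE :: "state \<Rightarrow> nat \<Rightarrow> nat set" and cU cE :: "state \<Rightarrow> nat \<Rightarrow> nat \<Rightarrow> nat \<Rightarrow> nat"
    and MU :: nat and ME :: "state \<Rightarrow> nat \<Rightarrow> nat"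
  assumes filter: "\<lbrakk>A \<subseteq> {1..K}; k \<in> A\<rbrakk> \<Longrightarrow> zero_forcing K pos h A k (G A k)"
    and filter_gain: "\<lbrakk>A \<subseteq> {1..K}; k \<in> A\<rbrakk> \<Longrightarrow> \<tau> * (\<Sum>l\<in>A. \<bar>G A k l\<bar>) < \<Delta> / 2"
    and spacing_pos: "0 < \<Delta>"
    and slots: "TU s k \<subseteq> {1..n}" "TE s k \<subseteq> {1..n}"
    and quiet: "\<lbrakk>k \<in> urllc K s; t \<in> TU s k; j \<in> neighbours K pos k; j \<in> active K s\<rbrakk>
      \<Longrightarrow> t \<notin> TU s j \<and> t \<notin> TE s j"
    and slots_disjoint: "t \<in> TE s k \<Longrightarrow> t \<notin> TU s k"
    and separated_U: "k \<in> urllc K s \<Longrightarrow> separated_code (TU s k) (2 * r) MU (cU s k)"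
    and separated_E: "k \<in> active K s \<Longrightarrow> separated_code (TE s k) (2 * r) (ME s k) (cE s k)"
begin

text \<open>\<open>G {k} k k\<close> is the reciprocal of the direct gain of \<open>k\<close>. The
  eMBB decoder filters the message of round \<open>K * K\<close>, one that is never sent, since
  rounds are numbered from 0.\<close>

definition code :: block_code where
  "code = \<lparr>
     encoder = (\<lambda>s k mU mE t. \<Delta> * real (if t \<in> TU s k then cU s k mU t
                                      else if t \<in> TE s k then cE s k mE t else 0)),
     urllc_decoder = (\<lambda>s k y. bounded_distance_decoder (TU s k) r \<Delta> (cU s k) MU
                        (\<lambda>t. G {k} k k * y t)),
     rounds = K * K,
     coop = (\<lambda>q j k s. relay n K pos s q j),
     embb_decoder = (\<lambda>s k x. bounded_distance_decoder (TE s k) r \<Delta> (cE s k) (ME s k)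
                        (\<lambda>t. \<Sum>l\<in>component K pos s k. G (component K pos s k) k l *
                               relay n K pos s (K * K) k x (prod_encode (l, t))))\<rparr>"

lemma finite_slots: "finite (TU s k)" "finite (TE s k)"
  by (rule finite_subset[OF slots(1)], simp) (rule finite_subset[OF slots(2)], simp)

lemma measurable_code: "measurable_code K pos n code"
  unfolding measurable_code_def
proof (intro conjI allI)
  fix s k
  have "(\<lambda>y. G {k} k k * y t) \<in> borel_measurable (output_space n)" if "t \<in> TU s k" for t
    using measurable_output[of t n] slots(1)[of s k] that by (intro borel_measurable_times) auto
  then show "urllc_decoder code s k \<in> output_space n \<rightarrow>\<^sub>M count_space UNIV"
    unfolding code_def by (simp add: measurable_bounded_distance_decoder finite_slots)
next
  fix q j k s
  show "coop code q j k s \<in> output_space n \<Otimes>\<^sub>M history_space K pos s j q \<rightarrow>\<^sub>M borel"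
    unfolding code_def by (simp add: measurable_relay)
next
  fix s k
  let ?N = "output_space n \<Otimes>\<^sub>M history_space K pos s k (K * K)"
  have "(\<lambda>x. \<Sum>l\<in>component K pos s k. G (component K pos s k) k l *
      relay n K pos s (K * K) k x (prod_encode (l, t))) \<in> borel_measurable ?N" for t
    using measurable_compose[OF measurable_relay measurable_product_coordinates]
    by (intro borel_measurable_sum borel_measurable_times) auto
  then show "embb_decoder code s k
      \<in> output_space n \<Otimes>\<^sub>M history_space K pos s k (rounds code) \<rightarrow>\<^sub>M count_space UNIV"
    unfolding code_def by (simp add: measurable_bounded_distance_decoder finite_slots)
qed

text \<open>With silence outside \<open>A\<close> the outputs in \<open>A\<close> involve just the
  channel matrix of \<open>A\<close>, whose inverse returns the input of \<open>k\<close> plus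
  filtered noise.\<close>

lemma filtered_output:
  assumes A: "A \<subseteq> {1..K}" "k \<in> A" and t: "t \<in> {1..n}"
    and silent: "\<And>l j. \<lbrakk>l \<in> A; j \<in> neighbours K pos l; j \<notin> A\<rbrakk> \<Longrightarrow> X j t = 0"
  shows "(\<Sum>l\<in>A. G A k l * channel_output K pos h n X z l t) = X k t + (\<Sum>l\<in>A. G A k l * z (l, t))"
proof -
  have out: "channel_output K pos h n X z l t =
      (h l l * X l t + (\<Sum>j\<in>neighbours K pos l \<inter> A. h j l * X j t)) + z (l, t)" if "l \<in> A" for l
  proof -
    have "finite (neighbours K pos l)" by (simp add: neighbours_def)
    then have "(\<Sum>j\<in>neighbours K pos l. h j l * X j t)
        = (\<Sum>j\<in>neighbours K pos l \<inter> A. h j l * X j t)"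
      using silent[OF that] by (intro sum.mono_neutral_right) auto
    then show ?thesis using t by (simp add: channel_output_def)
  qed
  have "(\<Sum>l\<in>A. G A k l * channel_output K pos h n X z l t)
      = (\<Sum>l\<in>A. G A k l * (h l l * X l t + (\<Sum>j\<in>neighbours K pos l \<inter> A. h j l * X j t)))
        + (\<Sum>l\<in>A. G A k l * z (l, t))"
    using out by (simp add: distrib_left sum.distrib)
  also have "\<dots> = X k t + (\<Sum>l\<in>A. G A k l * z (l, t))"
    using filter[OF A] unfolding zero_forcing_def by (simp add: spec[of _ "\<lambda>j. X j t"])
  finally show ?thesis .
qed

text \<open>By \<open>filter_gain\<close> an error of half the spacing forces a noise sample of that
  slot above \<open>\<tau>\<close>. Different slots have different samples, so unreliable slots are
  at most as many as exceedances.\<close>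

lemma few_unreliable_slots:
  assumes few: "card {i \<in> {1..K} \<times> {1..n}. \<tau> < \<bar>z i\<bar>} \<le> r"
    and A: "A \<subseteq> {1..K}" "k \<in> A" and T: "T \<subseteq> {1..n}"
    and e: "\<And>t. t \<in> T \<Longrightarrow> e t - x t = (\<Sum>l\<in>A. G A k l * z (l, t))"
  shows "card {t\<in>T. \<Delta> / 2 \<le> \<bar>e t - x t\<bar>} \<le> r"
proof -
  let ?B = "{i \<in> {1..K} \<times> {1..n}. \<tau> < \<bar>z i\<bar>}"
  have "{t\<in>T. \<Delta> / 2 \<le> \<bar>e t - x t\<bar>} \<subseteq> snd ` ?B"
  proof
    fix t assume t: "t \<in> {t\<in>T. \<Delta> / 2 \<le> \<bar>e t - x t\<bar>}"
    have "\<exists>l\<in>A. \<tau> < \<bar>z (l, t)\<bar>"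
    proof (rule ccontr)
      assume "\<not> (\<exists>l\<in>A. \<tau> < \<bar>z (l, t)\<bar>)"
      then have small: "\<bar>z (l, t)\<bar> \<le> \<tau>" if "l \<in> A" for l using that by force
      have "\<bar>e t - x t\<bar> \<le> (\<Sum>l\<in>A. \<bar>G A k l\<bar> * \<bar>z (l, t)\<bar>)"
        using e[of t] t sum_abs[of "\<lambda>l. G A k l * z (l, t)" A] by (simp add: abs_mult)
      also have "\<dots> \<le> (\<Sum>l\<in>A. \<bar>G A k l\<bar> * \<tau>)"
        using small by (intro sum_mono mult_left_mono) auto
      also have "\<dots> < \<Delta> / 2"
        using filter_gain[OF A] by (simp add: sum_distrib_left mult.commute)
      finally show False using t by simp
    qed
    then obtain l where "l \<in> A" "\<tau> < \<bar>z (l, t)\<bar>" by blast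
    then have "(l, t) \<in> ?B" using A(1) T t by auto
    then show "t \<in> snd ` ?B" by force
  qed
  then have "card {t\<in>T. \<Delta> / 2 \<le> \<bar>e t - x t\<bar>} \<le> card (snd ` ?B)"
    by (intro card_mono) auto
  also have "\<dots> \<le> card ?B" by (intro card_image_le) auto
  finally show ?thesis using few by simp
qed

lemma urllc_subset_active: "urllc K s \<subseteq> active K s"
  unfolding urllc_def active_def by auto

lemma no_decoding_error:
  assumes mU: "\<And>k. k \<in> urllc K s \<Longrightarrow> mU k \<in> {1..MU}"
    and mE: "\<And>k. k \<in> embb K s \<Longrightarrow> mE k \<in> {1..ME s k}"
    and few: "card {i \<in> {1..K} \<times> {1..n}. \<tau> < \<bar>z i\<bar>} \<le> r"
  shows "\<not> decoding_error K pos h n code s mU mE z"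
proof -
  define X where "X = channel_input K code s mU mE"
  define Y where "Y = channel_output K pos h n X z"
  have XU: "X k t = \<Delta> * real (cU s k (mU k) t)" if "k \<in> urllc K s" "t \<in> TU s k" for k t
    using that urllc_subset_active by (auto simp: X_def channel_input_def code_def)
  \<comment> \<open>The encoder tests the URLLC slots first, hence the appeal to
    \<open>slots_disjoint\<close>.\<close>
  have XE: "X k t = \<Delta> * real (cE s k (mE k) t)" if "k \<in> active K s" "t \<in> TE s k" for k t
    using that slots_disjoint by (auto simp: X_def channel_input_def code_def)
  have "urllc_decoder code s k (Y k) = mU k" if k: "k \<in> urllc K s" for k
  proof -
    have A: "{k} \<subseteq> {1..K}" "k \<in> {k}" using k by (auto simp: urllc_def)
    have silent: "X j t = 0" if "t \<in> TU s k" "j \<in> neighbours K pos k" for j t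
      using quiet[OF k that] by (auto simp: X_def channel_input_def code_def)
    have e: "G {k} k k * Y k t - \<Delta> * real (cU s k (mU k) t) = (\<Sum>l\<in>{k}. G {k} k l * z (l, t))"
      if t: "t \<in> TU s k" for t
    proof -
      have "t \<in> {1..n}" using slots(1) t by blast
      then show ?thesis
        using filtered_output[OF A, of t X z] silent[OF t] XU[OF k t] by (simp add: Y_def)
    qed
    show ?thesis
      unfolding code_def block_code.simps
      by (rule bounded_distance_decoder_correct[OF finite_slots(1) spacing_pos separated_U[OF k] mU[OF k]
            few_unreliable_slots[OF few A slots(1) e]])
  qed
  moreover have "embb_decoder code s k (Y k, received K pos code s Y (rounds code) k) = mE k"
    if k': "k \<in> embb K s" for k
  proof -
    have k: "k \<in> active K s" using k' by (simp add: embb_def)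
    then have kK: "k \<in> {1..K}" by (simp add: active_def)
    \<comment> \<open>Filtering uses the whole component here, against the singleton
      \<open>{k}\<close> for URLLC.\<close>
    let ?A = "component K pos s k"
    have A: "?A \<subseteq> {1..K}" "k \<in> ?A" using component_subset[OF kK] self_in_component by auto
    have silent: "X j t = 0" if "l \<in> ?A" "j \<in> neighbours K pos l" "j \<notin> ?A" for l j t
      using component_closed[OF kK that(1,2)] that(3) by (auto simp: X_def channel_input_def)
    have rel: "relay n K pos s (K * K) k (Y k, received K pos code s Y (K * K) k) (prod_encode (l, t))
        = Y l t" if "l \<in> ?A" "t \<in> {1..n}" for l t
      using that kK by (intro relay_correct) (simp_all add: code_def component_eq_hop_ball)
    have e: "(\<Sum>l\<in>?A. G ?A k l *
          relay n K pos s (K * K) k (Y k, received K pos code s Y (K * K) k) (prod_encode (l, t)))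
        - \<Delta> * real (cE s k (mE k) t) = (\<Sum>l\<in>?A. G ?A k l * z (l, t))" if t: "t \<in> TE s k" for t
    proof -
      have "t \<in> {1..n}" using slots(2) t by blast
      then show ?thesis
        using filtered_output[OF A, of t X z] silent XE[OF k t] rel by (simp add: Y_def)
    qed
    have R: "rounds code = K * K" by (simp add: code_def)
    have D: "embb_decoder code = (\<lambda>s k x. bounded_distance_decoder (TE s k) r \<Delta> (cE s k) (ME s k)
                        (\<lambda>t. \<Sum>l\<in>component K pos s k. G (component K pos s k) k l *
                               relay n K pos s (K * K) k x (prod_encode (l, t))))"
      by (simp add: code_def)
    show ?thesis
      unfolding R D
      by (rule bounded_distance_decoder_correct[OF finite_slots(2) spacing_pos separated_E[OF k] mE[OF k']
            few_unreliable_slots[OF few A slots(2) e]])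
  qed
  ultimately show ?thesis
    unfolding decoding_error_def Let_def X_def[symmetric] Y_def[symmetric] by blast
qed

end

section \<open>Message sets, error probability and the power constraint\<close>

lemma num_messages_pos: "0 \<le> R \<Longrightarrow> 1 \<le> num_messages n R"
  unfolding num_messages_def by (simp add: le_nat_iff le_floor_iff ge_one_powr_ge_zero)

lemma num_messages_0 [simp]: "num_messages n 0 = 1"
  unfolding num_messages_def by simp

lemma source_support:
  assumes mem: "(s, mU, mE) \<in> set_pmf (source K \<rho> \<rho>f n RU rE)"
    and R: "0 \<le> RU" "\<And>s k. 0 \<le> rE s k"
  shows "k \<in> urllc K s \<Longrightarrow> mU k \<in> {1..num_messages n RU}"
    and "k \<in> embb K s \<Longrightarrow> mE k \<in> {1..num_messages n (rE s k)}"
proof -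
  have fin: "finite (urllc K s)" "finite (embb K s)"
    by (auto simp: urllc_def embb_def active_def)
  have ne: "{1..num_messages n RU} \<noteq> {}" "{1..num_messages n (rE s k)} \<noteq> {}" for k
    using num_messages_pos[OF R(1)] num_messages_pos[OF R(2)] by auto
  have "mU \<in> set_pmf (Pi_pmf (urllc K s) 0 (\<lambda>_. pmf_of_set {1..num_messages n RU}))"
    and "mE \<in> set_pmf (Pi_pmf (embb K s) 0 (\<lambda>k. pmf_of_set {1..num_messages n (rE s k)}))"
    using mem unfolding source_def by (auto simp: set_bind_pmf)
  then show "k \<in> urllc K s \<Longrightarrow> mU k \<in> {1..num_messages n RU}"
    and "k \<in> embb K s \<Longrightarrow> mE k \<in> {1..num_messages n (rE s k)}"
    unfolding set_Pi_pmf[OF fin(1)] set_Pi_pmf[OF fin(2)] PiE_dflt_def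
    using ne by (auto simp: set_pmf_of_set)
qed

lemma prob_space_noise: "prob_space (noise K n)"
  unfolding noise_def by (intro prob_space_PiM prob_space_std_normal)

text \<open>Averaging a bound that is uniform over states and messages; the interval also records
  nonnegativity, for a later sandwich argument.\<close>

lemma error_probability_bound:
  assumes "\<And>s mU mE. (s, mU, mE) \<in> set_pmf (source K \<rho> \<rho>f n RU rE) \<Longrightarrow>
      measure (noise K n) {z \<in> space (noise K n). decoding_error K pos h n C s mU mE z} \<le> \<eta>"
  shows "error_probability K pos h \<rho> \<rho>f n RU rE C \<in> {0..\<eta>}"
proof -
  interpret N: prob_space "noise K n" by (rule prob_space_noise)
  let ?f = "\<lambda>(s, mU, mE).
    measure (noise K n) {z \<in> space (noise K n). decoding_error K pos h n C s mU mE z}"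
  have "integrable (measure_pmf (source K \<rho> \<rho>f n RU rE)) ?f"
    by (rule measure_pmf.integrable_const_bound[of _ 1]) (auto intro!: AE_pmfI)
  then have "measure_pmf.expectation (source K \<rho> \<rho>f n RU rE) ?f \<le> \<eta>"
    using assms by (intro measure_pmf.integral_le_const AE_pmfI) auto
  moreover have "0 \<le> measure_pmf.expectation (source K \<rho> \<rho>f n RU rE) ?f"
    by (rule integral_nonneg_AE) (auto intro!: AE_pmfI)
  ultimately show ?thesis unfolding error_probability_def by simp
qed

text \<open>At rate 0 the only message is 1, which the decoders always announce. At positive rates
  the code fills in for short blocks, where errors do not count.\<close>

definition silent_code :: block_code where
  "silent_code = \<lparr>encoder = (\<lambda>_ _ _ _ _. 0), urllc_decoder = (\<lambda>_ _ _. 1), rounds = 0,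
     coop = (\<lambda>_ _ _ _ _ _. 0), embb_decoder = (\<lambda>_ _ _. 1)\<rparr>"

lemma measurable_silent_code: "measurable_code K pos n silent_code"
  unfolding measurable_code_def silent_code_def by simp

lemma power_constraint_silent_code: "0 < P \<Longrightarrow> power_constraint K \<rho> \<rho>f n P RU rE silent_code"
  unfolding power_constraint_def silent_code_def channel_input_def by (auto intro!: AE_pmfI)

text \<open>Serves the powers below the threshold of the scheme, since rates are demanded for every
  \<open>P > 0\<close>.\<close>

lemma achievable_zero_rates:
  assumes "0 < P"
  shows "achievable_rates K pos h \<rho> \<rho>f P 0 0"
proof -
  have "error_probability K pos h \<rho> \<rho>f n 0 (\<lambda>_ _. 0) silent_code \<in> {0..0}" for n
  proof (rule error_probability_bound)
    fix s mU mE assume mem: "(s, mU, mE) \<in> set_pmf (source K \<rho> \<rho>f n 0 (\<lambda>_ _. 0))"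
    have "\<not> decoding_error K pos h n silent_code s mU mE z" for z
      using source_support[OF mem] by (auto simp: decoding_error_def silent_code_def)
    then show "measure (noise K n) {z \<in> space (noise K n).
        decoding_error K pos h n silent_code s mU mE z} \<le> 0" by simp
  qed
  then show ?thesis
    unfolding achievable_rates_def
    using assms measurable_silent_code power_constraint_silent_code
    by (intro conjI exI[of _ "\<lambda>_ _. 0"] exI[of _ "\<lambda>_. silent_code"]) auto
qed

context slotted_scheme
begin

lemma power_constraint_code:
  assumes n: "1 \<le> n" and q: "\<And>s k m t. cU s k m t < q" "\<And>s k m t. cE s k m t < q"
    and P: "\<Delta> * real q \<le> sqrt P" "0 < P"
  shows "power_constraint K \<rho> \<rho>f n P RU rE code"
proof -
  \<comment> \<open>Every single amplitude is at most \<open>\<Delta> * q \<le> sqrt P\<close>, so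
    the power bound holds symbol by symbol.\<close>
  have "(channel_input K code s mU mE k t)\<^sup>2 \<le> P" for s mU mE k t
  proof -
    have "\<bar>channel_input K code s mU mE k t\<bar> \<le> \<Delta> * real q"
    proof -
      have "\<Delta> * real c \<le> \<Delta> * real q" if "c < q" for c
        using that spacing_pos by (intro mult_left_mono) auto
      moreover have "0 < q" using q(1) by (metis gr_zeroI not_less_zero)
      ultimately show ?thesis
        using q spacing_pos by (auto simp: channel_input_def code_def intro: less_imp_le)
    qed
    also note P(1)
    finally have "(channel_input K code s mU mE k t)\<^sup>2 \<le> (sqrt P)\<^sup>2"
      by (metis abs_ge_zero power2_abs power_mono)
    then show ?thesis using P(2) by simp
  qed
  then have "1 / real n * (\<Sum>t=1..n. (channel_input K code s mU mE k t)\<^sup>2) \<le> P" for s mU mE k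
    using sum_bounded_above[of "{1..n}" "\<lambda>t. (channel_input K code s mU mE k t)\<^sup>2" P] n
    by (simp add: field_simps)
  then show ?thesis
    unfolding power_constraint_def by (auto intro!: AE_pmfI)
qed

text \<open>For all states and messages in the support of the source, the error event lies inside
  the same exceedance event of the noise.\<close>

lemma error_probability_code:
  assumes R: "0 \<le> RU" "\<And>s k. 0 \<le> rE s k"
    and M: "MU = num_messages n RU" "ME = (\<lambda>s k. num_messages n (rE s k))"
    and N: "0 < N" "r = n div N"
    and \<tau>: "measure std_normal_distribution {x. \<tau> < \<bar>x\<bar>} \<le> (1/2) ^ (Suc K * N)"
  shows "error_probability K pos h \<rho> \<rho>f n RU rE code \<in> {0..(1/2) ^ n}"
proof (rule error_probability_bound)
  fix s mU mE assume mem: "(s, mU, mE) \<in> set_pmf (source K \<rho> \<rho>f n RU rE)"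
  interpret N: prob_space "noise K n" by (rule prob_space_noise)
  let ?B = "{z \<in> space (noise K n). n div N < card {i \<in> {1..K} \<times> {1..n}. \<tau> < \<bar>z i\<bar>}}"
  have B: "?B \<in> sets (noise K n)" unfolding noise_def by (rule exceedance_event) auto
  have "{z \<in> space (noise K n). decoding_error K pos h n code s mU mE z} \<subseteq> ?B"
  proof safe
    fix z assume "decoding_error K pos h n code s mU mE z"
    then have "\<not> card {i \<in> {1..K} \<times> {1..n}. \<tau> < \<bar>z i\<bar>} \<le> r"
      using no_decoding_error[of s mU mE z] source_support[OF mem R] M by auto
    then show "n div N < card {i \<in> {1..K} \<times> {1..n}. \<tau> < \<bar>z i\<bar>}" using N(2) by simp
  qed
  then have "measure (noise K n) {z \<in> space (noise K n). decoding_error K pos h n code s mU mE z}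
      \<le> measure (noise K n) ?B"
    using B by (rule N.finite_measure_mono)
  also have "\<dots> \<le> (1/2) ^ n" using N(1) \<tau> by (rule noise_exceedance)
  finally show "measure (noise K n) {z \<in> space (noise K n). decoding_error K pos h n code s mU mE z}
      \<le> (1/2) ^ n" .
qed

end

text \<open>A comparison of binary exponents. Here \<open>x\<close> is half the logarithm of the
  power, \<open>c\<close> the constant loss of the alphabet, and \<open>a\<close> the number of
  slots, a share \<open>\<theta>\<close> of the block up to rounding.\<close>

lemma gilbert_varshamov_rate:
  assumes \<epsilon>: "0 < \<epsilon>" "\<theta> \<le> 1" and N: "4 / \<epsilon> \<le> real N" and q: "1 \<le> q"
    and lq: "x - c \<le> log 2 (real q)" "1 \<le> log 2 (real q)"
    and x: "\<bar>c\<bar> + 1 \<le> \<epsilon> / 4 * x"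
    and a: "\<theta> * real n - 1 \<le> real a" "a \<le> n" and n: "4 / \<epsilon> \<le> real n"
  shows "(num_messages n (max 0 (\<theta> - \<epsilon>) * x) - 1) * (2 ^ a * q ^ (2 * (n div N))) < q ^ a"
proof (cases "\<theta> \<le> \<epsilon>")
  case True
  \<comment> \<open>The rate is 0 and there is one message, so the left side is 0.\<close>
  then show ?thesis using q by (simp add: max_def)
next
  case False
  define l where "l = log 2 (real q)"
  define R where "R = (\<theta> - \<epsilon>) * x"
  define M where "M = num_messages n R"
  define r where "r = n div N"
  have x0: "0 \<le> x" using x \<epsilon>(1) by (smt (verit) divide_pos_pos mult_pos_neg)
  have R0: "0 \<le> R" using False x0 by (simp add: R_def)
  have Npos: "0 < real N" using N \<epsilon>(1) by (smt (verit) divide_pos_pos)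
  have qpow: "real q ^ k = 2 powr (real k * l)" for k
    using q by (simp add: l_def powr_mult_base powr_powr[symmetric] mult.commute[of "real k"] powr_realpow)
  have "1 \<le> M" unfolding M_def by (rule num_messages_pos[OF R0])
  moreover have "real M \<le> 2 powr (real n * R)"
    unfolding M_def num_messages_def by simp
  ultimately have M1: "real (M - 1) < 2 powr (real n * R)" by simp
  have r: "real r \<le> \<epsilon> / 4 * real n"
  proof -
    have "real r \<le> real n / real N" unfolding r_def by (rule of_nat_div_le_of_nat)
    also have "\<dots> \<le> real n / (4 / \<epsilon>)" using N \<epsilon>(1) Npos by (intro divide_left_mono) auto
    finally show ?thesis by (simp add: mult.commute)
  qed
  \<comment> \<open>How \<open>\<epsilon>\<close> is spent: half on the distance
    \<open>2 * r\<close>, a quarter on the slot lost by rounding, and a quarter on \<open>c\<close>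
    and the one bit per slot from the ball count.\<close>
  have exponent: "real n * R + (real a + real (2 * r) * l) \<le> real a * l"
  proof -
    have "real (2 * r) * l \<le> \<epsilon> / 2 * real n * l"
      using r lq(2) by (intro mult_right_mono) (auto simp: l_def)
    moreover have "(\<theta> * real n - 1) * (l - 1) \<le> real a * (l - 1)"
      using a(1) lq(2) by (intro mult_right_mono) (auto simp: l_def)
    moreover have "l \<le> \<epsilon> / 4 * real n * l"
    proof -
      have "1 \<le> \<epsilon> / 4 * real n" using n \<epsilon>(1) by (simp add: field_simps)
      then show ?thesis using lq(2) mult_right_mono[of 1 "\<epsilon> / 4 * real n" l] by (simp add: l_def)
    qed
    moreover have "real n * ((\<theta> - \<epsilon>) * x) \<le> real n * ((\<theta> - 3 * \<epsilon> / 4) * l - 1)"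
    proof (rule mult_left_mono)
      define A where "A = \<theta> - 3 * \<epsilon> / 4"
      have A: "0 \<le> A" "A \<le> 1" using False \<epsilon> by (simp_all add: A_def)
      have "A * c \<le> A * \<bar>c\<bar>" using A(1) by (intro mult_left_mono) auto
      also have "\<dots> \<le> 1 * \<bar>c\<bar>" using A(2) by (intro mult_right_mono) auto
      finally have Ac: "A * c \<le> \<epsilon> / 4 * x - 1" using x by simp
      have "(\<theta> - \<epsilon>) * x = A * x - \<epsilon> / 4 * x" by (simp add: A_def field_simps)
      also have "\<dots> \<le> A * (x - c) - 1" using Ac by (simp add: right_diff_distrib)
      also have "\<dots> \<le> A * l - 1" using A(1) lq(1) by (simp add: l_def mult_left_mono)
      finally show "(\<theta> - \<epsilon>) * x \<le> (\<theta> - 3 * \<epsilon> / 4) * l - 1" by (simp add: A_def)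
    qed simp
    moreover have "\<theta> * real n \<le> real n" using \<epsilon>(2) mult_right_mono[of \<theta> 1 "real n"] by simp
    ultimately show ?thesis unfolding R_def by (simp add: algebra_simps)
  qed
  have "real (M - 1) * (2 ^ a * real q ^ (2 * r))
      = real (M - 1) * 2 powr (real a + real (2 * r) * l)"
    by (simp only: qpow powr_add powr_realpow[symmetric, OF zero_less_numeral])
  also have "\<dots> < 2 powr (real n * R) * 2 powr (real a + real (2 * r) * l)"
    using M1 by (intro mult_strict_right_mono) auto
  also have "\<dots> = 2 powr (real n * R + (real a + real (2 * r) * l))"
    by (simp add: powr_add)
  also have "\<dots> \<le> 2 powr (real a * l)" using exponent by (intro powr_mono) auto
  also have "\<dots> = real q ^ a" by (rule qpow[symmetric])
  finally have "real ((M - 1) * (2 ^ a * q ^ (2 * r))) < real (q ^ a)" by simp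
  then have "(M - 1) * (2 ^ a * q ^ (2 * r)) < q ^ a" by (simp only: of_nat_less_iff)
  moreover have "max 0 (\<theta> - \<epsilon>) * x = R" using False by (simp add: R_def max_def)
  ultimately show ?thesis by (simp add: M_def r_def)
qed

section \<open>Colours and slots\<close>

definition colour :: "(nat \<Rightarrow> int \<times> int) \<Rightarrow> nat \<Rightarrow> nat" where
  "colour pos k = nat ((fst (pos k) + snd (pos k)) mod 3)"

lemma int_colour: "int (colour pos k) = (fst (pos k) + snd (pos k)) mod 3"
  by (simp add: colour_def)

lemma colour_less: "colour pos k < 3"
  by (simp add: colour_def nat_less_iff)

lemma neighbours_sym:
  "\<lbrakk>j \<in> neighbours K pos k; k \<in> {1..K}\<rbrakk> \<Longrightarrow> k \<in> neighbours K pos j"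
  unfolding neighbours_def adjacent_iff_dist by (subst dist_commute) simp

lemma colour_difference:
  "(int (colour pos j) - int (colour pos k)) mod 3
     = ((fst (pos j) - fst (pos k)) + (snd (pos j) - snd (pos k))) mod 3"
  unfolding int_colour mod_diff_eq by (rule arg_cong[where f = "\<lambda>x. x mod 3"]) simp

text \<open>The six offsets have coordinate sums 1, -1, 2 and -2, none divisible by 3.\<close>

lemma colour_neighbours:
  assumes "j \<in> neighbours K pos k"
  shows "colour pos j \<noteq> colour pos k"
proof
  assume eq: "colour pos j = colour pos k"
  have "(fst (pos j) - fst (pos k), snd (pos j) - snd (pos k))
     \<in> {(1, 0), (-1, 0), (0, 1), (0, -1), (1, 1), (-1, -1)}"
    using assms by (simp add: neighbours_def adjacent_def)
  then show False using colour_difference[of pos j k] unfolding eq by auto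
qed

text \<open>The coordinate sum modulo 3 splits the six offsets into two triples, and distinct
  positions make a neighbour determined by its offset.\<close>

lemma card_colour_neighbours_le:
  assumes inj: "inj_on pos {1..K}"
  shows "card {j \<in> neighbours K pos k. colour pos j = c} \<le> 3"
proof -
  let ?J = "{j \<in> neighbours K pos k. colour pos j = c}"
  define f where "f j = (fst (pos j) - fst (pos k), snd (pos j) - snd (pos k))" for j
  \<comment> \<open>Residue 0 does not occur for a neighbour, so it may share the second
    branch.\<close>
  define D where "D = (if (int c - int (colour pos k)) mod 3 = 1
    then {(1, 0), (0, 1), (-1, -1)} else {(-1, 0), (0, -1), (1 :: int, 1 :: int)})"
  have "inj_on f ?J"
  proof (rule inj_onI)
    fix i j assume ij: "i \<in> ?J" "j \<in> ?J" "f i = f j"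
    then have "pos i = pos j" by (simp add: f_def prod_eq_iff)
    then show "i = j" using inj_onD[OF inj \<open>pos i = pos j\<close>] ij(1,2) by (simp add: neighbours_def)
  qed
  moreover have "f ` ?J \<subseteq> D"
  proof
    fix d assume "d \<in> f ` ?J"
    then obtain j where j: "j \<in> neighbours K pos k" "colour pos j = c" "d = f j" by auto
    have "d \<in> {(1, 0), (-1, 0), (0, 1), (0, -1), (1, 1), (-1, -1)}"
      using j(1,3) by (simp add: neighbours_def adjacent_def f_def)
    moreover have "(int c - int (colour pos k)) mod 3 = (fst d + snd d) mod 3"
      using colour_difference[of pos j k] j by (simp add: f_def)
    ultimately show "d \<in> D" unfolding D_def by auto
  qed
  moreover have "finite D" "card D = 3" unfolding D_def by auto
  ultimately show ?thesis using card_inj_on_le[of f ?J D] by simp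
qed

section \<open>Assignment of time slots\<close>

definition colour_slots :: "nat \<Rightarrow> nat \<Rightarrow> nat set" where
  "colour_slots m c = {c * m<..c * m + m}"

lemma colour_slots_unique:
  assumes "t \<in> colour_slots m c" "t \<in> colour_slots m d"
  shows "c = d"
proof (rule ccontr)
  assume "c \<noteq> d"
  then consider "Suc c \<le> d" | "Suc d \<le> c" by linarith
  then show False
  proof cases
    case 1
    then have "Suc c * m \<le> d * m" by (rule mult_le_mono1)
    then show False using assms by (simp add: colour_slots_def)
  next
    case 2
    then have "Suc d * m \<le> c * m" by (rule mult_le_mono1)
    then show False using assms by (simp add: colour_slots_def)
  qed
qed

text \<open>The cell \<open>k\<close> itself is included because it cannot send both its messages in
  one slot.\<close>

definition blockers :: "nat \<Rightarrow> (nat \<Rightarrow> int \<times> int) \<Rightarrow> nat \<Rightarrow> nat \<Rightarrow> nat set" where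
  "blockers K pos k c = {j \<in> {1..K}. colour pos j = c \<and> (j = k \<or> j \<in> neighbours K pos k)}"

definition clear :: "nat \<Rightarrow> (nat \<Rightarrow> int \<times> int) \<Rightarrow> state \<Rightarrow> nat \<Rightarrow> nat \<Rightarrow> bool" where
  "clear K pos s k c \<longleftrightarrow> blockers K pos k c \<inter> urllc K s = {}"

definition urllc_slots :: "nat \<Rightarrow> (nat \<Rightarrow> int \<times> int) \<Rightarrow> nat \<Rightarrow> state \<Rightarrow> nat \<Rightarrow> nat set" where
  "urllc_slots K pos m s k = (if k \<in> urllc K s then colour_slots m (colour pos k) else {})"

text \<open>The blocks of the three colours tile \<open>{1..3 * m}\<close>; the later slots meet the
  condition vacuously and are open to every active cell.\<close>

definition embb_slots ::
  "nat \<Rightarrow> (nat \<Rightarrow> int \<times> int) \<Rightarrow> nat \<Rightarrow> nat \<Rightarrow> state \<Rightarrow> nat \<Rightarrow> nat set" where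
  "embb_slots K pos n m s k = {t \<in> {1..n}. \<forall>c<3. t \<in> colour_slots m c \<longrightarrow> clear K pos s k c}"

definition embb_fraction :: "nat \<Rightarrow> (nat \<Rightarrow> int \<times> int) \<Rightarrow> real \<Rightarrow> state \<Rightarrow> nat \<Rightarrow> real" where
  "embb_fraction K pos lam s k = (1 - lam) + lam / 3 * (\<Sum>c<3. of_bool (clear K pos s k c))"

lemma urllc_slots_subset:
  assumes "3 * m \<le> n" shows "urllc_slots K pos m s k \<subseteq> {1..n}"
proof -
  have "colour pos k * m \<le> 2 * m" using colour_less[of pos k] by (intro mult_le_mono1) auto
  then have "colour_slots m (colour pos k) \<subseteq> {1..n}"
    unfolding colour_slots_def using assms
    by (intro subsetI) (simp only: greaterThanAtMost_iff atLeastAtMost_iff, linarith)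
  then show ?thesis by (simp add: urllc_slots_def)
qed

lemma embb_slots_subset: "embb_slots K pos n m s k \<subseteq> {1..n}"
  by (auto simp: embb_slots_def)

text \<open>A neighbour of \<open>k\<close> has another colour, so its URLLC block is a different
  one, and \<open>k\<close> is a blocker that keeps its eMBB signal out of the block of
  \<open>k\<close>.\<close>

lemma urllc_slots_quiet:
  assumes k: "k \<in> urllc K s" and t: "t \<in> urllc_slots K pos m s k" and j: "j \<in> neighbours K pos k"
  shows "t \<notin> urllc_slots K pos m s j" and "t \<notin> embb_slots K pos n m s j"
proof -
  have t': "t \<in> colour_slots m (colour pos k)" using k t by (simp add: urllc_slots_def)
  show "t \<notin> urllc_slots K pos m s j"
    using colour_slots_unique[OF t'] colour_neighbours[OF j] by (auto simp: urllc_slots_def)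
  have "k \<in> {1..K}" using k by (simp add: urllc_def)
  then have "k \<in> blockers K pos j (colour pos k)"
    using neighbours_sym[OF j] by (simp add: blockers_def)
  then have "\<not> clear K pos s j (colour pos k)" using k by (auto simp: clear_def)
  then show "t \<notin> embb_slots K pos n m s j"
    using t' colour_less[of pos k] by (auto simp: embb_slots_def)
qed

lemma embb_slots_disjoint: "t \<in> embb_slots K pos n m s k \<Longrightarrow> t \<notin> urllc_slots K pos m s k"
proof
  assume E: "t \<in> embb_slots K pos n m s k" and U: "t \<in> urllc_slots K pos m s k"
  have k: "k \<in> urllc K s" "t \<in> colour_slots m (colour pos k)"
    using U by (auto simp: urllc_slots_def split: if_splits)
  then have "clear K pos s k (colour pos k)" using E colour_less[of pos k] by (auto simp: embb_slots_def)
  then show False using k(1) by (auto simp: clear_def blockers_def urllc_def)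
qed

lemma card_urllc_slots: "k \<in> urllc K s \<Longrightarrow> card (urllc_slots K pos m s k) = m"
  by (simp add: urllc_slots_def colour_slots_def)

text \<open>Counting the lost slots: each colour that is not clear removes at most \<open>m\<close>
  of them, so rounding \<open>m\<close> down can only help eMBB.\<close>

lemma card_embb_slots:
  assumes m: "real m \<le> lam * real n / 3"
  shows "embb_fraction K pos lam s k * real n \<le> real (card (embb_slots K pos n m s k))"
proof -
  define B where "B = {c. c < 3 \<and> \<not> clear K pos s k c}"
  have fin: "finite B" unfolding B_def by simp
  have "{1..n} \<subseteq> embb_slots K pos n m s k \<union> (\<Union>c\<in>B. colour_slots m c)"
    by (auto simp: embb_slots_def B_def)
  moreover have finU: "finite (embb_slots K pos n m s k \<union> (\<Union>c\<in>B. colour_slots m c))"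
    using fin by (simp add: embb_slots_def colour_slots_def)
  ultimately have "card {1..n} \<le> card (embb_slots K pos n m s k \<union> (\<Union>c\<in>B. colour_slots m c))"
    by (intro card_mono)
  also have "\<dots> \<le> card (embb_slots K pos n m s k) + card (\<Union>c\<in>B. colour_slots m c)"
    by (rule card_Un_le)
  also have "card (\<Union>c\<in>B. colour_slots m c) \<le> (\<Sum>c\<in>B. card (colour_slots m c))"
    by (rule card_UN_le[OF fin])
  also have "\<dots> = card B * m" by (simp add: colour_slots_def)
  finally have "n \<le> card (embb_slots K pos n m s k) + card B * m" by simp
  then have "real n \<le> real (card (embb_slots K pos n m s k)) + real (card B) * real m"
    by (metis of_nat_add of_nat_le_iff of_nat_mult)
  also have "real (card B) * real m \<le> real (card B) * (lam * real n / 3)"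
    using m by (intro mult_left_mono) auto
  finally have le: "real n - real (card B) * (lam * real n / 3) \<le> real (card (embb_slots K pos n m s k))"
    by simp
  have "(\<Sum>c<3. of_bool (clear K pos s k c)) + real (card B)
      = (\<Sum>c<3. of_bool (clear K pos s k c) + of_bool (\<not> clear K pos s k c))"
    unfolding sum.distrib B_def by (simp add: Int_def lessThan_def)
  also have "\<dots> = (\<Sum>c<3::nat. 1)" by (intro sum.cong) auto
  finally have clear_count: "(\<Sum>c<3. of_bool (clear K pos s k c)) = 3 - real (card B)" by simp
  have "embb_fraction K pos lam s k * real n = real n - real (card B) * (lam * real n / 3)"
    unfolding embb_fraction_def clear_count by (simp add: field_simps)
  then show ?thesis using le by simp
qed

lemma embb_fraction_le_1: "0 \<le> lam \<Longrightarrow> embb_fraction K pos lam s k \<le> 1"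
proof -
  assume lam: "0 \<le> lam"
  have "(\<Sum>c<3. of_bool (clear K pos s k c) :: real) \<le> (\<Sum>c<3::nat. 1)" by (intro sum_mono) simp
  then have "lam / 3 * (\<Sum>c<3. of_bool (clear K pos s k c)) \<le> lam / 3 * 3"
    using lam by (intro mult_left_mono) auto
  then show ?thesis unfolding embb_fraction_def by simp
qed

section \<open>Probabilities of activity and of clear colours\<close>

lemma prob_cell_activity:
  assumes "0 \<le> \<rho>" "\<rho> \<le> 1" "0 \<le> \<rho>f" "\<rho>f \<le> 1"
  shows "measure_pmf.prob (cell_activity \<rho> \<rho>f) {x. fst x} = \<rho>"
    and "measure_pmf.prob (cell_activity \<rho> \<rho>f) {x. fst x \<and> \<not> snd x} = \<rho> * (1 - \<rho>f)"
    and "measure_pmf.prob (cell_activity \<rho> \<rho>f) {x. \<not> (fst x \<and> snd x)} = 1 - \<rho> * \<rho>f"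
proof -
  have bools: "{x. x} = {True}" "Collect Not = {False}" by auto
  have pmf: "pmf (cell_activity \<rho> \<rho>f) (True, True) = \<rho> * \<rho>f"
      "pmf (cell_activity \<rho> \<rho>f) (True, False) = \<rho> * (1 - \<rho>f)"
      "pmf (cell_activity \<rho> \<rho>f) (False, False) = 1 - \<rho>"
      "pmf (cell_activity \<rho> \<rho>f) (False, True) = 0"
    using assms by (simp_all add: cell_activity_def pmf_bind pmf_map vimage_def bools measure_pmf_single)
  have sets: "{x :: bool \<times> bool. fst x} = {(True, True), (True, False)}"
    "{x :: bool \<times> bool. fst x \<and> \<not> snd x} = {(True, False)}"
    "{x :: bool \<times> bool. \<not> (fst x \<and> snd x)} = {(True, False), (False, False), (False, True)}"
    by auto
  show "measure_pmf.prob (cell_activity \<rho> \<rho>f) {x. fst x} = \<rho>"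
    and "measure_pmf.prob (cell_activity \<rho> \<rho>f) {x. fst x \<and> \<not> snd x} = \<rho> * (1 - \<rho>f)"
    and "measure_pmf.prob (cell_activity \<rho> \<rho>f) {x. \<not> (fst x \<and> snd x)} = 1 - \<rho> * \<rho>f"
    unfolding sets by (simp_all add: measure_measure_pmf_finite pmf algebra_simps)
qed

lemma prob_activity_cylinder:
  assumes "J \<subseteq> {1..K}"
  shows "measure_pmf.prob (activity K \<rho> \<rho>f) {s. \<forall>j\<in>J. s j \<in> B j}
       = (\<Prod>j\<in>J. measure_pmf.prob (cell_activity \<rho> \<rho>f) (B j))"
proof -
  let ?B = "\<lambda>j. if j \<in> J then B j else UNIV"
  have "{s. \<forall>j\<in>J. s j \<in> B j} = Pi {1..K} ?B" using assms by (auto simp: Pi_def)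
  then have "measure_pmf.prob (activity K \<rho> \<rho>f) {s. \<forall>j\<in>J. s j \<in> B j}
      = (\<Prod>j\<in>{1..K}. measure_pmf.prob (cell_activity \<rho> \<rho>f) (?B j))"
    unfolding activity_def by (simp add: measure_Pi_pmf_Pi)
  also have "\<dots> = (\<Prod>j\<in>J. measure_pmf.prob (cell_activity \<rho> \<rho>f) (B j))"
    using assms by (intro prod.mono_neutral_cong_right) auto
  finally show ?thesis .
qed

lemma prob_active:
  assumes "0 \<le> \<rho>" "\<rho> \<le> 1" "0 \<le> \<rho>f" "\<rho>f \<le> 1" and k: "k \<in> {1..K}"
  shows "measure_pmf.prob (activity K \<rho> \<rho>f) {s. k \<in> active K s} = \<rho>"
proof -
  have "{s. k \<in> active K s} = {s. \<forall>j\<in>{k}. s j \<in> {x. fst x}}" using k by (auto simp: active_def)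
  then show ?thesis using prob_activity_cylinder[of "{k}" K \<rho> \<rho>f "\<lambda>_. {x. fst x}"] k assms
    by (simp add: prob_cell_activity)
qed

text \<open>Neighbours differ in colour, so the only blocker is \<open>k\<close> itself.\<close>

lemma prob_active_clear_own:
  assumes "0 \<le> \<rho>" "\<rho> \<le> 1" "0 \<le> \<rho>f" "\<rho>f \<le> 1" and k: "k \<in> {1..K}"
  shows "measure_pmf.prob (activity K \<rho> \<rho>f) {s. k \<in> active K s \<and> clear K pos s k (colour pos k)}
    = \<rho> * (1 - \<rho>f)"
proof -
  have "blockers K pos k (colour pos k) = {k}"
    using k colour_neighbours by (auto simp: blockers_def)
  then have "{s. k \<in> active K s \<and> clear K pos s k (colour pos k)}
      = {s. \<forall>j\<in>{k}. s j \<in> {x. fst x \<and> \<not> snd x}}"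
    using k by (auto simp: active_def clear_def urllc_def)
  then show ?thesis
    using prob_activity_cylinder[of "{k}" K \<rho> \<rho>f "\<lambda>_. {x. fst x \<and> \<not> snd x}"] k assms
    by (simp add: prob_cell_activity)
qed

text \<open>Here \<open>k\<close> is no blocker, and the at most three blockers are independent of
  it and of each other. Missing neighbours at the border only raise the probability.\<close>

lemma prob_active_clear_other:
  assumes r: "0 \<le> \<rho>" "\<rho> \<le> 1" "0 \<le> \<rho>f" "\<rho>f \<le> 1" and k: "k \<in> {1..K}"
    and c: "c \<noteq> colour pos k" and inj: "inj_on pos {1..K}"
  shows "\<rho> * (1 - \<rho> * \<rho>f) ^ 3
    \<le> measure_pmf.prob (activity K \<rho> \<rho>f) {s. k \<in> active K s \<and> clear K pos s k c}"
proof -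
  let ?J = "{j \<in> neighbours K pos k. colour pos j = c}"
  define B where "B j = (if j = k then {x :: bool \<times> bool. fst x} else {x. \<not> (fst x \<and> snd x)})" for j
  have J: "?J \<subseteq> {1..K}" "finite ?J" by (auto simp: neighbours_def)
  have kJ: "k \<notin> ?J" using c by auto
  have blk: "blockers K pos k c = ?J" using c J by (auto simp: blockers_def)
  have mem: "j \<notin> urllc K s \<longleftrightarrow> s j \<in> B j" if "j \<in> ?J" for j s
  proof -
    have "j \<in> {1..K}" "j \<noteq> k" using that J(1) kJ by blast+
    then show ?thesis by (simp add: urllc_def B_def)
  qed
  have "clear K pos s k c \<longleftrightarrow> (\<forall>j\<in>?J. s j \<in> B j)" for s
    unfolding clear_def blk disjoint_iff Ball_def[symmetric] by (rule ball_cong[OF refl mem])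
  then have "{s. k \<in> active K s \<and> clear K pos s k c} = {s. \<forall>j\<in>insert k ?J. s j \<in> B j}"
    using k by (auto simp: active_def B_def)
  then have "measure_pmf.prob (activity K \<rho> \<rho>f) {s. k \<in> active K s \<and> clear K pos s k c}
      = (\<Prod>j\<in>insert k ?J. measure_pmf.prob (cell_activity \<rho> \<rho>f) (B j))"
    using prob_activity_cylinder[of "insert k ?J" K \<rho> \<rho>f B] J(1) k by simp
  also have "\<dots> = \<rho> * (\<Prod>j\<in>?J. measure_pmf.prob (cell_activity \<rho> \<rho>f) (B j))"
    using J(2) kJ r by (simp add: B_def prob_cell_activity)
  also have "(\<Prod>j\<in>?J. measure_pmf.prob (cell_activity \<rho> \<rho>f) (B j)) = (\<Prod>j\<in>?J. 1 - \<rho> * \<rho>f)"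
    using kJ prob_cell_activity(3)[OF r] by (intro prod.cong) (auto simp: B_def)
  also have "\<dots> = (1 - \<rho> * \<rho>f) ^ card ?J" by simp
  finally have eq: "measure_pmf.prob (activity K \<rho> \<rho>f) {s. k \<in> active K s \<and> clear K pos s k c}
      = \<rho> * (1 - \<rho> * \<rho>f) ^ card ?J" .
  have "(1 - \<rho> * \<rho>f) ^ 3 \<le> (1 - \<rho> * \<rho>f) ^ card ?J"
    using card_colour_neighbours_le[OF inj] r by (intro power_decreasing) (auto simp: mult_le_one)
  then show ?thesis unfolding eq using r(1) by (rule mult_left_mono)
qed

lemma finite_set_activity: "finite (set_pmf (activity K \<rho> \<rho>f))"
proof -
  have "set_pmf (activity K \<rho> \<rho>f) \<subseteq> PiE_dflt {1..K} (False, False) (\<lambda>_. UNIV)"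
    unfolding activity_def by (auto simp: set_Pi_pmf PiE_dflt_def)
  then show ?thesis by (rule finite_subset) (simp add: finite_PiE_dflt)
qed

text \<open>Linearity of expectation, after the random index set is turned into an indicator over
  all cells. Every cell obeys the same bound: one own colour and two others.\<close>

lemma expected_embb_fraction:
  fixes \<rho> \<rho>f lam :: real
  assumes r: "0 \<le> \<rho>" "\<rho> \<le> 1" "0 \<le> \<rho>f" "\<rho>f \<le> 1" and inj: "inj_on pos {1..K}"
    and lam: "0 \<le> lam" and K: "1 \<le> K"
  shows "(1 - lam) * \<rho> + lam / 3 * (\<rho> * (1 - \<rho>f) + 2 * (\<rho> * (1 - \<rho> * \<rho>f) ^ 3))
    \<le> measure_pmf.expectation (activity K \<rho> \<rho>f)
        (\<lambda>s. 1 / real K * (\<Sum>k\<in>active K s. embb_fraction K pos lam s k))"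
    (is "?v \<le> _")
proof -
  let ?M = "measure_pmf (activity K \<rho> \<rho>f)"
  have int: "integrable ?M f" for f :: "state \<Rightarrow> real"
    by (rule integrable_measure_pmf_finite[OF finite_set_activity])
  have prob: "measure_pmf.expectation (activity K \<rho> \<rho>f) (\<lambda>s. of_bool (Q s))
      = measure_pmf.prob (activity K \<rho> \<rho>f) {s. Q s}" for Q
  proof -
    have "(\<lambda>s. of_bool (Q s)) = (indicator {s. Q s} :: state \<Rightarrow> real)"
      by (auto simp: indicator_def)
    then show ?thesis by simp
  qed
  have one: "?v \<le> measure_pmf.expectation (activity K \<rho> \<rho>f)
        (\<lambda>s. of_bool (k \<in> active K s) * embb_fraction K pos lam s k)" (is "_ \<le> ?e")
    if k: "k \<in> {1..K}" for k
  proof -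
    let ?p = "\<lambda>c. measure_pmf.prob (activity K \<rho> \<rho>f) {s. k \<in> active K s \<and> clear K pos s k c}"
    have "?e = measure_pmf.expectation (activity K \<rho> \<rho>f) (\<lambda>s. (1 - lam) * of_bool (k \<in> active K s)
        + lam / 3 * (\<Sum>c<3. of_bool (k \<in> active K s \<and> clear K pos s k c)))"
      by (intro Bochner_Integration.integral_cong) (auto simp: embb_fraction_def)
    also have "\<dots> = (1 - lam) * \<rho> + lam / 3 * (\<Sum>c<3. ?p c)"
      using prob_active[OF r k] by (simp add: int prob Bochner_Integration.integral_add del: sum_of_bool_eq)
    finally have e: "?e = (1 - lam) * \<rho> + lam / 3 * (\<Sum>c<3. ?p c)" .
    have "(\<Sum>c<3. ?p c) = ?p (colour pos k) + (\<Sum>c\<in>{..<3} - {colour pos k}. ?p c)"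
      using colour_less by (intro sum.remove) auto
    moreover have "(\<Sum>c\<in>{..<3} - {colour pos k}. \<rho> * (1 - \<rho> * \<rho>f) ^ 3)
        \<le> (\<Sum>c\<in>{..<3} - {colour pos k}. ?p c)"
      using prob_active_clear_other[OF r k _ inj] by (intro sum_mono) auto
    moreover have "card ({..<3} - {colour pos k}) = 2" using colour_less by simp
    ultimately have "\<rho> * (1 - \<rho>f) + 2 * (\<rho> * (1 - \<rho> * \<rho>f) ^ 3) \<le> (\<Sum>c<3. ?p c)"
      using prob_active_clear_own[OF r k] by simp
    then have "lam / 3 * (\<rho> * (1 - \<rho>f) + 2 * (\<rho> * (1 - \<rho> * \<rho>f) ^ 3)) \<le> lam / 3 * (\<Sum>c<3. ?p c)"
      using lam by (intro mult_left_mono) auto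
    then show ?thesis unfolding e by simp
  qed
  have "real K * ?v = (\<Sum>k\<in>{1..K}. ?v)" by simp
  also have "\<dots> \<le> (\<Sum>k\<in>{1..K}. measure_pmf.expectation (activity K \<rho> \<rho>f)
        (\<lambda>s. of_bool (k \<in> active K s) * embb_fraction K pos lam s k))"
    by (intro sum_mono one)
  also have "\<dots> = measure_pmf.expectation (activity K \<rho> \<rho>f)
        (\<lambda>s. \<Sum>k\<in>{1..K}. of_bool (k \<in> active K s) * embb_fraction K pos lam s k)"
    by (rule Bochner_Integration.integral_sum[symmetric]) (rule int)
  also have "(\<lambda>s. \<Sum>k\<in>{1..K}. of_bool (k \<in> active K s) * embb_fraction K pos lam s k)
      = (\<lambda>s. \<Sum>k\<in>active K s. embb_fraction K pos lam s k)"
    by (intro ext sum.mono_neutral_cong_right) (auto simp: active_def)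
  finally have "real K * ?v \<le> measure_pmf.expectation (activity K \<rho> \<rho>f)
      (\<lambda>s. \<Sum>k\<in>active K s. embb_fraction K pos lam s k)" .
  then show ?thesis using K by (simp add: field_simps)
qed

section \<open>Achievable multiplexing gains\<close>

text \<open>Finitely many pairs of a set and a cell occur, so the sum of all filter weights is a
  common bound; it is independent of the power.\<close>

lemma bounded_zero_forcing:
  assumes ns: "nonsingular_channels K pos h"
  shows "\<exists>\<Gamma> G. 0 \<le> \<Gamma> \<and> (\<forall>A\<subseteq>{1..K}. \<forall>k\<in>A.
    zero_forcing K pos h A k (G A k) \<and> (\<Sum>l\<in>A. \<bar>G A k l\<bar>) \<le> \<Gamma>)"
proof (intro exI conjI allI impI ballI)
  define G where "G A k = (SOME g. zero_forcing K pos h A k g)" for A k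
  define \<Gamma> where "\<Gamma> = (\<Sum>A\<in>Pow {1..K}. \<Sum>k\<in>{1..K}. \<Sum>l\<in>A. \<bar>G A k l\<bar>)"
  show "0 \<le> \<Gamma>" unfolding \<Gamma>_def by (intro sum_nonneg) auto
  fix A k assume A: "A \<subseteq> {1..K}" "k \<in> A"
  show "zero_forcing K pos h A k (G A k)"
    unfolding G_def by (rule someI_ex[OF zero_forcing_filter_exists[OF ns A]])
  have "(\<Sum>l\<in>A. \<bar>G A k l\<bar>) \<le> (\<Sum>k\<in>{1..K}. \<Sum>l\<in>A. \<bar>G A k l\<bar>)"
    using A by (intro member_le_sum) (auto intro!: sum_nonneg)
  also have "\<dots> \<le> \<Gamma>"
    unfolding \<Gamma>_def using A by (intro member_le_sum) (auto intro!: sum_nonneg)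
  finally show "(\<Sum>l\<in>A. \<bar>G A k l\<bar>) \<le> \<Gamma>" .
qed

definition gv_code :: "nat set \<Rightarrow> nat \<Rightarrow> nat \<Rightarrow> nat \<Rightarrow> nat \<Rightarrow> nat \<Rightarrow> nat" where
  "gv_code T d q M = (SOME c. (\<forall>m t. c m t < q) \<and>
    ((M - 1) * (2 ^ card T * q ^ d) < q ^ card T \<longrightarrow> separated_code T d M c))"

lemma gv_code:
  assumes "finite T" "0 < q"
  shows "gv_code T d q M m t < q"
    and "(M - 1) * (2 ^ card T * q ^ d) < q ^ card T \<Longrightarrow> separated_code T d M (gv_code T d q M)"
  using someI_ex[OF gilbert_varshamov[OF assms, of M d]] unfolding gv_code_def by blast+

text \<open>Once \<open>sqrt P / \<Delta>\<close> is at least 2, rounding down loses at most a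
  factor 2, so \<open>log 2 q\<close> stays within the constant \<open>log 2 (2 * \<Delta>)\<close>
  of half the logarithm of \<open>P\<close>. The other bounds hold because the latter tends to
  infinity.\<close>

lemma eventually_alphabet_size:
  fixes \<Delta> c' :: real
  assumes \<Delta>: "0 < \<Delta>" and \<epsilon>: "0 < \<epsilon>"
  shows "eventually (\<lambda>P. let q = nat \<lfloor>sqrt P / \<Delta>\<rfloor>; x = 1 / 2 * log 2 P; c = log 2 (2 * \<Delta>) in
    1 \<le> P \<and> 1 \<le> q \<and> \<Delta> * real q \<le> sqrt P \<and> x - c \<le> log 2 (real q) \<and> 1 \<le> log 2 (real q)
    \<and> \<bar>c\<bar> + 1 \<le> \<epsilon> / 4 * x) at_top"
proof -
  define c where "c = log 2 (2 * \<Delta>)"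
  have lim: "filterlim (\<lambda>P :: real. 1 / 2 * log 2 P) at_top at_top"
  proof -
    have "filterlim (\<lambda>P :: real. 1 / (2 * ln 2) * ln P) at_top at_top"
      by (rule filterlim_tendsto_pos_mult_at_top[OF tendsto_const _ ln_at_top]) simp
    then show ?thesis by (simp add: log_def)
  qed
  have ev: "eventually (\<lambda>P :: real. M \<le> 1 / 2 * log 2 P) at_top" for M
    using lim by (simp add: filterlim_at_top)
  have "eventually (\<lambda>P. max 1 ((2 * \<Delta>)\<^sup>2) \<le> P) at_top" by (rule eventually_ge_at_top)
  then show ?thesis
    using ev[of "1 + c"] ev[of "(\<bar>c\<bar> + 1) / (\<epsilon> / 4)"]
  proof eventually_elim
    case (elim P)
    define y where "y = sqrt P / \<Delta>"
    define q where "q = nat \<lfloor>y\<rfloor>"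
    have P: "1 \<le> P" "(2 * \<Delta>)\<^sup>2 \<le> P" using elim(1) by auto
    have "2 * \<Delta> \<le> sqrt P" using P(2) by (rule real_le_rsqrt)
    then have y: "2 \<le> y" using \<Delta> by (simp add: y_def field_simps)
    then have q: "y - 1 < real q" "real q \<le> y" unfolding q_def by linarith+
    have half: "y / 2 \<le> real q" using q(1) y by linarith
    have "\<Delta> * real q \<le> sqrt P" using q(2) \<Delta> by (simp add: y_def field_simps)
    moreover have "1 / 2 * log 2 P - c = log 2 (y / 2)"
    proof -
      have "ln (y / 2) = ln (sqrt P / (2 * \<Delta>))" by (simp add: y_def mult.commute)
      also have "\<dots> = ln P / 2 - ln (2 * \<Delta>)"
        using P(1) \<Delta> ln_div[of "sqrt P" "2 * \<Delta>"] by (simp add: ln_sqrt)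
      finally show ?thesis by (simp add: c_def log_def diff_divide_distrib)
    qed
    moreover have "log 2 (y / 2) \<le> log 2 (real q)" using half y by simp
    moreover have "\<bar>c\<bar> + 1 \<le> \<epsilon> / 4 * (1 / 2 * log 2 P)"
      using elim(3) \<epsilon> by (simp add: field_simps)
    moreover have "1 \<le> q" using q(1) y by linarith
    ultimately show ?case
      using P(1) elim(2) unfolding Let_def y_def[symmetric] q_def[symmetric] c_def[symmetric]
      by linarith
  qed
qed

text \<open>Order of choices: \<open>N\<close> from \<open>\<epsilon>\<close>, then
  \<open>\<tau>\<close> from \<open>N\<close> and \<open>K\<close>, then the spacing from
  \<open>\<tau>\<close> and the filter bound, and only then a large \<open>P\<close>.\<close>

lemma achievable_rates_eventually:
  fixes \<rho> \<rho>f lam \<epsilon> S :: real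
  assumes ns: "nonsingular_channels K pos h" and inj: "inj_on pos {1..K}" and K: "1 \<le> K"
    and r: "0 \<le> \<rho>" "\<rho> \<le> 1" "0 \<le> \<rho>f" "\<rho>f \<le> 1" and lam: "0 \<le> lam" "lam \<le> 1" and \<epsilon>: "0 < \<epsilon>"
    and S: "S \<le> (1 - lam) * \<rho> + lam / 3 * (\<rho> * (1 - \<rho>f) + 2 * (\<rho> * (1 - \<rho> * \<rho>f) ^ 3))"
  shows "eventually (\<lambda>P. achievable_rates K pos h \<rho> \<rho>f P
    (max 0 (lam / 3 - \<epsilon>) * (1 / 2 * log 2 P)) (max 0 (S - \<epsilon>) * (1 / 2 * log 2 P))) at_top"
proof -
  obtain \<Gamma> G where \<Gamma>: "0 \<le> \<Gamma>"
    and G: "\<forall>A\<subseteq>{1..K}. \<forall>k\<in>A. zero_forcing K pos h A k (G A k) \<and> (\<Sum>l\<in>A. \<bar>G A k l\<bar>) \<le> \<Gamma>"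
    using bounded_zero_forcing[OF ns] by (elim exE conjE)
  have filter: "zero_forcing K pos h A k (G A k)" and gain: "(\<Sum>l\<in>A. \<bar>G A k l\<bar>) \<le> \<Gamma>"
    if "A \<subseteq> {1..K}" "k \<in> A" for A k
    using G that by simp_all
  \<comment> \<open>Makes the number \<open>n div N\<close> of corrected errors at most
    \<open>\<epsilon> / 4 * n\<close>.\<close>
  define N where "N = nat \<lceil>4 / \<epsilon>\<rceil>"
  have N: "4 / \<epsilon> \<le> real N" unfolding N_def by linarith
  then have N0: "0 < N" using \<epsilon> by (cases N) (auto simp: divide_le_0_iff)
  obtain \<tau> where \<tau>: "0 \<le> \<tau>"
    "measure std_normal_distribution {x. \<tau> < \<bar>x\<bar>} \<le> (1/2) ^ (Suc K * N)"
    using normal_tail_small[of "(1/2) ^ (Suc K * N)"] by auto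
  \<comment> \<open>Filtered noise stays below half the spacing; the summand 1 gives strictness and
    positivity even if \<open>\<tau> * \<Gamma> = 0\<close>.\<close>
  define \<Delta> where "\<Delta> = 2 * (\<tau> * \<Gamma>) + 1"
  have \<Delta>: "0 < \<Delta>" using \<tau>(1) \<Gamma> by (simp add: \<Delta>_def add_nonneg_pos)
  have gain': "\<tau> * (\<Sum>l\<in>A. \<bar>G A k l\<bar>) < \<Delta> / 2" if "A \<subseteq> {1..K}" "k \<in> A" for A k
    using mult_left_mono[OF gain[OF that] \<tau>(1)] by (simp add: \<Delta>_def)
  show ?thesis
    using eventually_alphabet_size[OF \<Delta> \<epsilon>]
  proof eventually_elim
    case (elim P)
    define q where "q = nat \<lfloor>sqrt P / \<Delta>\<rfloor>"
    define x where "x = 1 / 2 * log 2 P"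
    define c where "c = log 2 (2 * \<Delta>)"
    have P: "1 \<le> P" and q: "1 \<le> q" "\<Delta> * real q \<le> sqrt P"
      and lq: "x - c \<le> log 2 (real q)" "1 \<le> log 2 (real q)" and xc: "\<bar>c\<bar> + 1 \<le> \<epsilon> / 4 * x"
      using elim unfolding Let_def q_def x_def c_def by blast+
    have x0: "0 \<le> x" using P by (simp add: x_def)
    define RU where "RU = max 0 (lam / 3 - \<epsilon>) * x"
    \<comment> \<open>The eMBB rate follows the state through the slots that are free in it, whereas
      \<open>RU\<close> is the same in all states.\<close>
    define rE where "rE s k = max 0 (embb_fraction K pos lam s k - \<epsilon>) * x" for s k
    have RU0: "0 \<le> RU" and rE0: "\<And>s k. 0 \<le> rE s k" using x0 by (simp_all add: RU_def rE_def)
    define m where "m n = nat \<lfloor>lam * real n / 3\<rfloor>" for n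
    have m: "real (m n) \<le> lam * real n / 3" "lam / 3 * real n - 1 \<le> real (m n)" for n
    proof -
      have "0 \<le> lam * real n / 3" using lam(1) by simp
      then show "real (m n) \<le> lam * real n / 3" unfolding m_def by linarith
      show "lam / 3 * real n - 1 \<le> real (m n)" unfolding m_def by simp linarith
    qed
    have m3: "3 * m n \<le> n" for n
    proof -
      have "lam * real n \<le> real n" using lam(2) mult_right_mono[of lam 1 "real n"] by simp
      then show ?thesis using m(1)[of n] by linarith
    qed
    define TU where "TU n = urllc_slots K pos (m n)" for n
    define TE where "TE n = embb_slots K pos n (m n)" for n
    have TU: "TU n s k \<subseteq> {1..n}" for n s k unfolding TU_def by (rule urllc_slots_subset[OF m3])
    have TE: "TE n s k \<subseteq> {1..n}" for n s k unfolding TE_def by (rule embb_slots_subset)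
    have fin: "finite (TU n s k)" "finite (TE n s k)" for n s k
      by (rule finite_subset[OF TU], simp) (rule finite_subset[OF TE], simp)
    have card_n: "card (TU n s k) \<le> n" "card (TE n s k) \<le> n" for n s k
      using card_mono[OF _ TU[of n s k]] card_mono[OF _ TE[of n s k]] by auto
    define MU where "MU n = num_messages n RU" for n
    define ME where "ME n s k = num_messages n (rE s k)" for n s k
    define cU where "cU n s k = gv_code (TU n s k) (2 * (n div N)) q (MU n)" for n s k
    define cE where "cE n s k = gv_code (TE n s k) (2 * (n div N)) q (ME n s k)" for n s k
    have q0: "0 < q" using q(1) by simp
    have c_less: "cU n s k i t < q" "cE n s k i t < q" for n s k i t
      unfolding cU_def cE_def by (rule gv_code(1)[OF fin(1) q0], rule gv_code(1)[OF fin(2) q0])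
    have sepU: "separated_code (TU n s k) (2 * (n div N)) (MU n) (cU n s k)"
      if n: "4 / \<epsilon> \<le> real n" and k: "k \<in> urllc K s" for n s k
    proof -
      have "lam / 3 * real n - 1 \<le> real (card (TU n s k))"
        using m(2)[of n] card_urllc_slots[OF k] by (simp add: TU_def)
      then show ?thesis
        unfolding cU_def MU_def RU_def using lam(2)
        by (intro gv_code(2) fin q0 gilbert_varshamov_rate[OF \<epsilon> _ N q(1) lq xc _ card_n(1) n]) auto
    qed
    have sepE: "separated_code (TE n s k) (2 * (n div N)) (ME n s k) (cE n s k)"
      if n: "4 / \<epsilon> \<le> real n" for n s k
    proof -
      have "embb_fraction K pos lam s k * real n - 1 \<le> real (card (TE n s k))"
        using card_embb_slots[OF m(1)[of n], of K pos s k] by (simp add: TE_def)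
      then show ?thesis
        unfolding cE_def ME_def rE_def using embb_fraction_le_1[OF lam(1)]
        by (intro gv_code(2) fin q0 gilbert_varshamov_rate[OF \<epsilon> _ N q(1) lq xc _ card_n(2) n]) auto
    qed
    have scheme: "slotted_scheme K pos h n (n div N) \<Delta> \<tau> G (TU n) (TE n) (cU n) (cE n) (MU n) (ME n)"
      if n: "4 / \<epsilon> \<le> real n" for n
    proof
      show "t \<notin> TU n s j \<and> t \<notin> TE n s j"
        if "k \<in> urllc K s" "t \<in> TU n s k" "j \<in> neighbours K pos k" "j \<in> active K s" for k s t j
        using urllc_slots_quiet[OF that(1) that(2)[unfolded TU_def] that(3)]
        unfolding TU_def TE_def by blast
      show "t \<notin> TU n s k" if "t \<in> TE n s k" for t s k
        using that unfolding TU_def TE_def by (rule embb_slots_disjoint)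
    qed (use filter gain' \<Delta> TU TE sepU[OF n] sepE[OF n] in \<open>simp_all\<close>)
    \<comment> \<open>Codes are separated only for blocks of length at least
      \<open>4 / \<epsilon>\<close>; shorter blocks merely have to be measurable and obey the power
      constraint.\<close>
    define C where "C n = (if 4 / \<epsilon> \<le> real n
      then slotted_scheme.code K pos n (n div N) \<Delta> G (TU n) (TE n) (cU n) (cE n) (MU n) (ME n)
      else silent_code)" for n
    have C_ok: "measurable_code K pos n (C n) \<and> power_constraint K \<rho> \<rho>f n P RU rE (C n)"
      if "1 \<le> n" for n
    proof (cases "4 / \<epsilon> \<le> real n")
      case True
      show ?thesis
        unfolding C_def
        using slotted_scheme.measurable_code[OF scheme[OF True]]
          slotted_scheme.power_constraint_code[OF scheme[OF True] that c_less q(2)] P True by simp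
    next
      case False
      then show ?thesis
        unfolding C_def using measurable_silent_code power_constraint_silent_code P by simp
    qed
    have err: "error_probability K pos h \<rho> \<rho>f n RU rE (C n) \<in> {0..(1/2) ^ n}"
      if n: "4 / \<epsilon> \<le> real n" for n
    proof -
      have "ME n = (\<lambda>s k. num_messages n (rE s k))" by (intro ext) (simp add: ME_def)
      then show ?thesis
        unfolding C_def using n
          slotted_scheme.error_probability_code[OF scheme[OF n] RU0 rE0 MU_def _ N0 refl \<tau>(2)]
        by simp
    qed
    have "eventually (\<lambda>n. 4 / \<epsilon> \<le> real n) sequentially"
      by (rule eventually_ge_at_top[THEN eventually_compose_filterlim, OF filterlim_real_sequentially])
    then have ev: "eventually (\<lambda>n. error_probability K pos h \<rho> \<rho>f n RU rE (C n) \<in> {0..(1/2) ^ n}) sequentially"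
      by (rule eventually_mono) (rule err)
    have lim: "(\<lambda>n. error_probability K pos h \<rho> \<rho>f n RU rE (C n)) \<longlonglongrightarrow> 0"
    proof (rule tendsto_sandwich[of "\<lambda>_. 0" _ _ "\<lambda>n. (1/2) ^ n"])
      show "(\<lambda>n. (1/2) ^ n) \<longlonglongrightarrow> (0::real)" by (rule LIMSEQ_realpow_zero) auto
    qed (use ev in \<open>auto elim: eventually_mono\<close>)
    have rate: "max 0 (S - \<epsilon>) * x
      \<le> measure_pmf.expectation (activity K \<rho> \<rho>f) (\<lambda>s. 1 / real K * (\<Sum>k\<in>embb K s. rE s k))"
      (is "_ \<le> ?e")
    proof -
      let ?f = "\<lambda>s. 1 / real K * (\<Sum>k\<in>active K s. embb_fraction K pos lam s k)"
      have int: "integrable (measure_pmf (activity K \<rho> \<rho>f)) f" for f :: "state \<Rightarrow> real"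
        by (rule integrable_measure_pmf_finite[OF finite_set_activity])
      have e0: "0 \<le> ?e"
        using rE0 by (intro integral_nonneg_AE AE_pmfI mult_nonneg_nonneg sum_nonneg) auto
      \<comment> \<open>At most \<open>K\<close> cells are active, so subtracting
        \<open>\<epsilon>\<close> per active cell costs at most \<open>\<epsilon>\<close> on
        average.\<close>
      have pointwise: "(?f s - \<epsilon>) * x \<le> 1 / real K * (\<Sum>k\<in>embb K s. rE s k)" for s
      proof -
        have "real (card (active K s)) \<le> real K"
        proof -
          have "active K s \<subseteq> {1..K}" by (auto simp: active_def)
          then show ?thesis using card_mono[of "{1..K}" "active K s"] by simp
        qed
        then have "1 / real K * real (card (active K s)) * \<epsilon> \<le> 1 * \<epsilon>"
          using \<epsilon> K by (intro mult_right_mono) (auto simp: field_simps)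
        then have "?f s - \<epsilon> \<le> 1 / real K * (\<Sum>k\<in>active K s. embb_fraction K pos lam s k - \<epsilon>)"
          by (simp add: sum_subtractf right_diff_distrib)
        then have "(?f s - \<epsilon>) * x \<le> 1 / real K * (\<Sum>k\<in>active K s. embb_fraction K pos lam s k - \<epsilon>) * x"
          using x0 by (rule mult_right_mono)
        also have "\<dots> = 1 / real K * (\<Sum>k\<in>active K s. (embb_fraction K pos lam s k - \<epsilon>) * x)"
          by (simp add: sum_distrib_right)
        also have "\<dots> \<le> 1 / real K * (\<Sum>k\<in>active K s. rE s k)"
          unfolding rE_def using x0 by (intro mult_left_mono sum_mono mult_right_mono) auto
        finally show ?thesis by (simp add: embb_def)
      qed
      have "(S - \<epsilon>) * x \<le> (measure_pmf.expectation (activity K \<rho> \<rho>f) ?f - \<epsilon>) * x"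
        using S expected_embb_fraction[OF r inj lam(1) K] x0 by (intro mult_right_mono) auto
      also have "\<dots> = measure_pmf.expectation (activity K \<rho> \<rho>f) (\<lambda>s. (?f s - \<epsilon>) * x)"
        using int by (simp del: times_divide_eq_left)
      also have "\<dots> \<le> ?e"
        by (rule integral_mono[OF int int pointwise])
      finally show ?thesis using e0 by (simp add: max_def)
    qed
    have "achievable_rates K pos h \<rho> \<rho>f P RU (max 0 (S - \<epsilon>) * x)"
      unfolding achievable_rates_def
      using RU0 x0 rE0 rate C_ok lim
      by (intro conjI exI[of _ rE] exI[of _ C]) auto
    then show ?case unfolding RU_def x_def .
  qed
qed

text \<open>Below a threshold the rates are set to 0, which the limit superior in \<open>P\<close>
  ignores. The threshold may depend on \<open>K\<close> because that limit is taken first.\<close>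

lemma achievable_MG_of_rates:
  assumes nonneg: "0 \<le> \<sigma>" "0 \<le> \<eta>"
    and ev: "\<And>K. 1 \<le> K \<Longrightarrow> eventually (\<lambda>P. achievable_rates K (pos K) (h K) \<rho> \<rho>f P
      (\<sigma> * (1 / 2 * log 2 P)) (\<eta> * (1 / 2 * log 2 P))) at_top"
  shows "achievable_MG pos h \<rho> \<rho>f (\<rho> * \<rho>f * \<sigma>, \<eta>)"
proof -
  have "\<exists>P0. 1 \<le> K \<longrightarrow> (\<forall>P\<ge>P0. achievable_rates K (pos K) (h K) \<rho> \<rho>f P
      (\<sigma> * (1 / 2 * log 2 P)) (\<eta> * (1 / 2 * log 2 P)))" for K
    using ev[of K] unfolding eventually_at_top_linorder by blast
  then obtain P0 where P0: "\<And>K P. \<lbrakk>1 \<le> K; P0 K \<le> P\<rbrakk> \<Longrightarrow> achievable_rates K (pos K) (h K) \<rho> \<rho>f P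
      (\<sigma> * (1 / 2 * log 2 P)) (\<eta> * (1 / 2 * log 2 P))"
    by metis
  define R where "R a K P = (if P0 K \<le> P then a * (1 / 2 * log 2 P) else 0)" for a :: real and K :: nat and P
  have lim: "limsup (\<lambda>K. Limsup at_top (\<lambda>P. ereal (R a K P / (1 / 2 * log 2 P)))) = ereal a" for a
  proof -
    have "Limsup at_top (\<lambda>P. ereal (R a K P / (1 / 2 * log 2 P))) = ereal a" for K
    proof (rule lim_imp_Limsup)
      have "eventually (\<lambda>P. max 2 (P0 K) \<le> P) at_top" by (rule eventually_ge_at_top)
      then have "eventually (\<lambda>P. ereal (R a K P / (1 / 2 * log 2 P)) = ereal a) at_top"
      proof (rule eventually_mono)
        fix P :: real assume P: "max 2 (P0 K) \<le> P"
        then have "log 2 P \<noteq> 0" using zero_less_log_cancel_iff[of 2 P] by linarith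
        then show "ereal (R a K P / (1 / 2 * log 2 P)) = ereal a" using P by (simp add: R_def)
      qed
      then show "((\<lambda>P. ereal (R a K P / (1 / 2 * log 2 P))) \<longlongrightarrow> ereal a) at_top"
        by (rule tendsto_eventually)
    qed simp
    then show ?thesis by (simp add: Limsup_const)
  qed
  have "achievable_rates K (pos K) (h K) \<rho> \<rho>f P (R \<sigma> K P) (R \<eta> K P)" if "1 \<le> K" "0 < P" for K P
    using P0[OF that(1), of P] achievable_zero_rates[OF that(2)] by (simp add: R_def)
  then show ?thesis
    unfolding achievable_MG_def fst_conv snd_conv
    by (intro exI[of _ "R \<sigma>"] exI[of _ "R \<eta>"]) (simp only: lim times_ereal.simps, simp)
qed

theorem theorem9:
  fixes pos :: "nat \<Rightarrow> nat \<Rightarrow> int \<times> int"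
    and h :: "nat \<Rightarrow> nat \<Rightarrow> nat \<Rightarrow> real"
    and \<rho> \<rho>f L :: real
  assumes distinct_cells: "\<And>K. inj_on (pos K) {1..K}"
    and gains_nonneg: "\<And>K j k. j \<in> {1..K} \<Longrightarrow> k \<in> {1..K} \<Longrightarrow> 0 \<le> h K j k"
    and gains_nonsingular: "\<And>K. nonsingular_channels K (pos K) (h K)"
    and rho: "0 < \<rho>" "\<rho> < 1"
    and rho_f: "0 < \<rho>f" "\<rho>f \<le> 1"
    and L_def: "L = (2 + \<rho>f - 2 * (1 - \<rho> * \<rho>f) ^ 3) / \<rho>f"
  shows "{(SU, SE). 0 \<le> SU \<and> 0 \<le> SE \<and> SU \<le> \<rho> * \<rho>f / 3 \<and> SE + L * SU \<le> \<rho>}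
           \<subseteq> MG_region pos h \<rho> \<rho>f"
proof safe
  fix SU SE
  assume SU: "0 \<le> SU" "SU \<le> \<rho> * \<rho>f / 3" and SE: "0 \<le> SE" "SE + L * SU \<le> \<rho>"
  \<comment> \<open>Solves \<open>SU = \<rho> * \<rho>f * (lam / 3)\<close>; the first constraint of
    the region then says \<open>lam \<le> 1\<close>.\<close>
  define lam where "lam = 3 * SU / (\<rho> * \<rho>f)"
  have lam: "0 \<le> lam" "lam \<le> 1" and SU_lam: "SU = \<rho> * \<rho>f * (lam / 3)"
    using SU rho rho_f by (simp_all add: lam_def field_simps)
  have "L * SU = (2 + \<rho>f - 2 * (1 - \<rho> * \<rho>f) ^ 3) * (\<rho> * (lam / 3))"
    using rho_f(1) by (simp add: L_def SU_lam)
  \<comment> \<open>The right side equals \<open>\<rho> - L * SU\<close>, so the second constraint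
    is exactly the eMBB bound of the scheme.\<close>
  then have S: "SE \<le> (1 - lam) * \<rho> + lam / 3 * (\<rho> * (1 - \<rho>f) + 2 * (\<rho> * (1 - \<rho> * \<rho>f) ^ 3))"
    using SE(2) by (simp add: algebra_simps)
  \<comment> \<open>The scheme attains each point up to \<open>\<epsilon> i\<close>; the closure in
    the definition of the region absorbs the slack.\<close>
  define \<epsilon> where "\<epsilon> i = inverse (real (Suc i))" for i
  define p where "p i = (\<rho> * \<rho>f * max 0 (lam / 3 - \<epsilon> i), max 0 (SE - \<epsilon> i))" for i
  have "achievable_MG pos h \<rho> \<rho>f (p i)" for i
  proof -
    have "0 < \<epsilon> i" by (simp add: \<epsilon>_def)
    then show ?thesis
      unfolding p_def using rho rho_f lam S
      by (intro achievable_MG_of_rates achievable_rates_eventually gains_nonsingular distinct_cells) auto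
  qed
  moreover have "p \<longlonglongrightarrow> (SU, SE)"
  proof -
    have "\<epsilon> \<longlonglongrightarrow> 0" unfolding \<epsilon>_def by (rule LIMSEQ_inverse_real_of_nat)
    then have "p \<longlonglongrightarrow> (\<rho> * \<rho>f * max 0 (lam / 3 - 0), max 0 (SE - 0))"
      unfolding p_def by (intro tendsto_intros)
    then show ?thesis using lam(1) SE(1) by (simp add: SU_lam)
  qed
  ultimately show "(SU, SE) \<in> MG_region pos h \<rho> \<rho>f"
    unfolding MG_region_def closure_sequential by blast
qed

end
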